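(* Let the data $X,K,X_j,\gamma_j,A,Y,\varphi,j,f,R,q,a_S$ satisfy the standing assumptions listed in the context, and let $j_c:X_j\to X_j^*$ be a linear operator such that $\|j_c(z)\|_{X_j^*}\le\alpha_c\|z\|_{X_j}$ and $\langle j_c(z),z\rangle_{X_j}\ge\alpha_j\|z\|_{X_j}^2$ for all $z\in X_j$. Let $T>0$, let $N$ be a positive integer, $k=T/N$, and let $u_0^k\in K$ be a prescribed initial value. Then (without any restriction on the size of $k$) there is a unique $u^k=\{u_n^k\}_{n=0}^N\subset K$ with this initial value such that for every $1\le n\le N$ and every $v\in K$, $$\langle Au_n^k,v-u_n^k\rangle+\varphi(\mathcal S_{n,L}^ku^k,u_{n-1}^k,v)-\varphi(\mathcal S_{n,L}^ku^k,u_{n-1}^k,u_n^k)+j^0(\gamma_ju_n^k;\gamma_jv-\gamma_ju_n^k)+\langle j_c(\gamma_ju_n^k),\gamma_jv-\gamma_ju_n^k\rangle_{X_j}$$ $$\ge\langle f_n,v-u_n^k\rangle+\langle j_c(\gamma_ju_{n-1}^k),\gamma_jv-\gamma_ju_n^k\rangle_{X_j}.$$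
   Context: Notation. All spaces are real. $\mathbb R_+=[0,\infty)$; $X^*,X_j^*$ are topological duals; $\langle\cdot,\cdot\rangle$ is the duality pairing between $X^*$ and $X$, $\langle\cdot,\cdot\rangle_{X_j}$ the one between $X_j^*$ and $X_j$; $\mathcal L(\cdot;\cdot)$ denotes bounded linear operators, $\mathcal L(X)=\mathcal L(X;X)$. For a locally Lipschitz $j:X_j\to\mathbb R$, the Clarke directional derivative is $j^0(x;v)=\limsup_{y\to x,\lambda\downarrow0}\frac{j(y+\lambda v)-j(y)}{\lambda}$ and $\partial j(x)=\{\xi\in X_j^*: j^0(x;v)\ge\langle\xi,v\rangle_{X_j}\ \forall v\in X_j\}$. Standing assumptions on the data. $X$ is a reflexive Banach space, $K\subset X$ is closed and convex, $0\in K$. $X_j$ is a Banach space, $\gamma_j\in\mathcal L(X;X_j)$ and $c_j>0$ satisfies $\|\gamma_jv\|_{X_j}\le c_j\|v\|_X$ for all $v\in X$. $A:X\to X^*$ is Lipschitz continuous with constant $L_A>0$ and strongly monotone: $\langle Av_1-Av_2,v_1-v_2\rangle\ge m_A\|v_1-v_2\|_X^2$ for all $v_1,v_2\in X$, with $m_A>0$. $Y$ is a normed space and $\varphi:Y\times K\times K\to\mathbb R$ is such that $\varphi(y,u,\cdot)$ is convex and lower semicontinuous on $K$ for all $y\in Y,u\in K$, and there are $\alpha_\varphi>0,\beta_\varphi>0$ with $\varphi(y_1,u_1,v_2)-\varphi(y_1,u_1,v_1)+\varphi(y_2,u_2,v_1)-\varphi(y_2,u_2,v_2)\le\alpha_\varphi\|u_1-u_2\|_X\|v_1-v_2\|_X+\beta_\varphi\|y_1-y_2\|_Y\|v_1-v_2\|_X$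 for all $y_1,y_2\in Y$, $u_1,u_2,v_1,v_2\in K$. The function $j:X_j\to\mathbb R$ is locally Lipschitz; there are $c_0,c_1\ge0$ with $\|\xi\|_{X_j^*}\le c_0+c_1\|z\|_{X_j}$ for all $z\in X_j$, $\xi\in\partial j(z)$; there is $\alpha_j>0$ with $j^0(z_1;z_2-z_1)+j^0(z_2;z_1-z_2)\le\alpha_j\|z_1-z_2\|_{X_j}^2$ for all $z_1,z_2\in X_j$. $f\in C(\mathbb R_+;X^* )$. $R\in\mathcal L(X;Y)$, $q\in C(\mathbb R_+\times\mathbb R_+;\mathcal L(X))$, $a_S\in X$; these define the history-dependent operator $(\mathcal Sv)(t)=R\left(\int_0^tq(t,s)v(s)\,ds+a_S\right)$ for $v\in C(\mathbb R_+;X)$. Time discretization. $t_n=nk$, $0\le n\le N$, $f_n=f(t_n)$. For a sequence $v=\{v_n\}$ in $X$ and $n\ge1$, $\mathcal S_{n,L}^kv=R\left(\frac k2q(t_n,t_0)v_0+k\sum_{i=1}^{n-1}q(t_n,t_i)v_i+\frac k2q(t_n,t_{n-1})v_{n-1}+a_S\right)$ (empty sum $=0$). *)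

theory Defs
  imports "HOL-Analysis.Analysis"
begin

text \<open>The topological dual of a real normed space \<open>'a\<close> is the space of bounded linear functions
  \<open>'a \<Rightarrow>\<^sub>L real\<close> with the operator norm; the duality pairing of \<open>\<xi>\<close> and \<open>v\<close> is the application
  \<open>\<xi> v\<close>, where \<open>blinfun_apply\<close> is inserted as a coercion.\<close>

type_synonym 'a dual = "'a \<Rightarrow>\<^sub>L real"

text \<open>Surjectivity of the canonical embedding into the bidual.\<close>

definition reflexive_space :: "'a::real_normed_vector itself \<Rightarrow> bool" where
  "reflexive_space _ \<longleftrightarrow> (\<forall>F :: 'a dual dual. \<exists>x :: 'a. \<forall>\<xi> :: 'a dual. blinfun_apply F \<xi> = blinfun_apply \<xi> x)"

definition locally_lipschitz :: "('a::metric_space \<Rightarrow> 'b::metric_space) \<Rightarrow> bool" where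
  "locally_lipschitz g \<longleftrightarrow> (\<forall>x. \<exists>r>0. \<exists>L. L-lipschitz_on (cball x r) g)"

definition lsc_on :: "'a::topological_space set \<Rightarrow> ('a \<Rightarrow> real) \<Rightarrow> bool" where
  "lsc_on S g \<longleftrightarrow> (\<forall>x\<in>S. \<forall>c<g x. \<forall>\<^sub>F y in at x within S. c < g y)"

definition strongly_monotone :: "real \<Rightarrow> ('a::real_normed_vector \<Rightarrow> 'a dual) \<Rightarrow> bool" where
  "strongly_monotone m A \<longleftrightarrow> (\<forall>v1 v2. blinfun_apply (A v1 - A v2) (v1 - v2) \<ge> m * (norm (v1 - v2))\<^sup>2)"

text \<open>The upper limit is joint in \<open>y \<rightarrow> x\<close> (the value \<open>y = x\<close> is allowed) and \<open>\<lambda> \<down> 0\<close>. It is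
  taken in the extended reals; for locally Lipschitz \<open>g\<close> it is finite, see
  \<open>clarke_deriv_finite\<close> below, so nothing is lost by returning to the reals.\<close>

definition clarke_deriv :: "('a::real_normed_vector \<Rightarrow> real) \<Rightarrow> 'a \<Rightarrow> 'a \<Rightarrow> real" where
  "clarke_deriv g x v = real_of_ereal
     (Limsup (nhds x \<times>\<^sub>F at_right 0) (\<lambda>(y, l). ereal ((g (y + l *\<^sub>R v) - g y) / l)))"

definition clarke_subdiff :: "('a::real_normed_vector \<Rightarrow> real) \<Rightarrow> 'a \<Rightarrow> 'a dual set" where
  "clarke_subdiff g x = {\<xi>. \<forall>v. clarke_deriv g x v \<ge> blinfun_apply \<xi> v}"

lemma clarke_deriv_finite:
  fixes g :: "'a::real_normed_vector \<Rightarrow> real"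
  assumes "locally_lipschitz g"
  shows "\<bar>Limsup (nhds x \<times>\<^sub>F at_right 0) (\<lambda>(y, l). ereal ((g (y + l *\<^sub>R v) - g y) / l))\<bar> \<noteq> \<infinity>"
proof -
  let ?F = "nhds x \<times>\<^sub>F at_right (0::real)"
  let ?q = "\<lambda>(y, l). ereal ((g (y + l *\<^sub>R v) - g y) / l)"
  from assms obtain r L where r: "r > 0" and L: "L-lipschitz_on (cball x r) g"
    unfolding locally_lipschitz_def by blast
  have nb: "?F \<noteq> bot"
    by (simp add: prod_filter_eq_bot)
  have fst: "((\<lambda>p. fst p) \<longlongrightarrow> x) ?F"
    using filterlim_fst by blast
  have snd: "((\<lambda>p. snd p) \<longlongrightarrow> (0::real)) ?F"
    by (rule filterlim_mono[OF filterlim_snd[of "at_right 0" "nhds x"] at_within_le_nhds order_refl])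
  have pos: "\<forall>\<^sub>F p in ?F. snd p > (0::real)"
    by (rule eventually_compose_filterlim[OF _ filterlim_snd]) (simp add: eventually_at_right_less)
  have "((\<lambda>p. fst p + snd p *\<^sub>R v) \<longlongrightarrow> x + 0 *\<^sub>R v) ?F"
    by (intro tendsto_intros fst snd)
  then have near2: "\<forall>\<^sub>F p in ?F. dist (fst p + snd p *\<^sub>R v) x < r"
    using r by (simp add: tendsto_iff)
  have near1: "\<forall>\<^sub>F p in ?F. dist (fst p) x < r"
    using fst r by (simp add: tendsto_iff)
  have bound: "\<forall>\<^sub>F p in ?F. ereal (- (L * norm v)) \<le> ?q p \<and> ?q p \<le> ereal (L * norm v)"
    using near1 near2 pos
  proof eventually_elim
    case (elim p)
    obtain y l where p: "p = (y, l)" by (cases p)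
    have "\<bar>g (y + l *\<^sub>R v) - g y\<bar> \<le> L * (l * norm v)"
      using lipschitz_onD[OF L, of "y + l *\<^sub>R v" y] elim
      by (simp add: p dist_commute dist_real_def dist_norm)
    then have "\<bar>g (y + l *\<^sub>R v) - g y\<bar> / l \<le> L * norm v"
      using elim by (simp add: p field_simps)
    then have "\<bar>(g (y + l *\<^sub>R v) - g y) / l\<bar> \<le> L * norm v"
      using elim by (simp add: p abs_divide)
    then show ?case
      unfolding p prod.case ereal_less_eq(3) abs_le_iff by linarith
  qed
  have le: "Limsup ?F ?q \<le> ereal (L * norm v)"
    by (rule Limsup_bounded) (use bound in \<open>auto elim: eventually_mono\<close>)
  have "ereal (- (L * norm v)) \<le> Liminf ?F ?q"
    by (rule Liminf_bounded) (use bound in \<open>auto elim: eventually_mono\<close>)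
  also have "\<dots> \<le> Limsup ?F ?q"
    by (rule Liminf_le_Limsup[OF nb])
  finally show ?thesis
    using le by (cases "Limsup ?F ?q") auto
qed

text \<open>The discrete history operator with step \<open>k\<close>, time nodes \<open>n * k\<close>; it is only meant for
  \<open>n \<ge> 1\<close>. It depends on \<open>v\<close> only through \<open>v 0, \<dots>, v (n - 1)\<close>: at the last node the trapezoidal
  rule uses \<open>q(t\<^sub>n, t\<^sub>n\<^sub>-\<^sub>1) v\<^sub>n\<^sub>-\<^sub>1\<close> instead of \<open>q(t\<^sub>n, t\<^sub>n) v\<^sub>n\<close>.\<close>

definition hist_sum ::
  "('x::real_normed_vector \<Rightarrow>\<^sub>L 'y::real_normed_vector) \<Rightarrow> (real \<Rightarrow> real \<Rightarrow> 'x \<Rightarrow>\<^sub>L 'x) \<Rightarrow> 'x \<Rightarrow> real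
    \<Rightarrow> (nat \<Rightarrow> 'x) \<Rightarrow> nat \<Rightarrow> 'y" where
  "hist_sum R q a k v n = R (
     (k / 2) *\<^sub>R q (real n * k) 0 (v 0)
     + k *\<^sub>R (\<Sum>i=1..n-1. q (real n * k) (real i * k) (v i))
     + (k / 2) *\<^sub>R q (real n * k) (real (n - 1) * k) (v (n - 1))
     + a)"

end

theory Submission
  imports Defs
begin

text \<open>
  The stabilizing operator \<open>j\<^sub>c\<close> is coercive with the same constant \<open>\<alpha>\<^sub>j\<close> that measures the failure of
  monotonicity of Clarke's subdifferential of \<open>j\<close>. Hence the sum of the implicit terms of the scheme is
  monotone, and with \<open>A\<close> it is strongly monotone, with a constant that does not involve the step
  size. The remaining terms at time level \<open>n\<close> (the history sum, the second argument of \<open>\<phi>\<close>, the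
  loads) depend only on \<open>u 0, \<dots>, u (n - 1)\<close>. So the scheme is a sequence of elliptic
  variational-hemivariational inequalities, each of which has exactly one solution
  (\<open>variational_hemivariational_unique_solution\<close>), and \<open>unique_recursive_sequence\<close> joins them.

  Such an elliptic inequality asks for \<open>u \<in> K\<close> with \<open>F u v \<ge> 0\<close> for all \<open>v \<in> K\<close>, where
  \<open>F u v + F v u \<le> - m |u - v|^2\<close> and \<open>F u\<close> is convex and lower semicontinuous. Uniqueness is
  immediate from adding two inequalities. Existence (\<open>strongly_monotone_equilibrium\<close>) is shown
  without a fixed point theorem. By Minty's trick it suffices to find \<open>u\<close> with \<open>F v u \<le> 0\<close> for all
  \<open>v\<close>; these are convex conditions on \<open>u\<close>. Any finite number of them can be satisfied up to
  an arbitrarily small error: otherwise a theorem of the alternative for convex functions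
  (\<open>convex_alternative\<close>) yields weights, and testing with the barycentre of the \<open>v\<close>'s with these same
  weights contradicts monotonicity (\<open>finite_approximate_minty_solution\<close>). Reflexivity then provides a point
  common to all the approximate solution sets (\<open>reflexive_directed_Inter\<close>). Both this and the
  separation of a point from a closed convex set rest on a Hahn--Banach theorem
  for sublinear functionals.
\<close>

section \<open>Sublinear functionals and the Hahn--Banach theorem\<close>

text \<open>Only one inequality is asked for in the homogeneity clause; applied to \<open>c\<close> and to \<open>1 / c\<close> it gives
  equality, and with \<open>c = 2\<close> and \<open>c = 1/2\<close> it forces the value \<open>0\<close> at the origin.\<close>

definition sublinear :: "('a::real_vector \<Rightarrow> real) \<Rightarrow> bool" where
  "sublinear p \<longleftrightarrow> (\<forall>x y. p (x + y) \<le> p x + p y) \<and> (\<forall>c>0. \<forall>x. p (c *\<^sub>R x) \<le> c * p x)"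

lemma sublinear_add: "sublinear p \<Longrightarrow> p (x + y) \<le> p x + p y"
  by (simp add: sublinear_def)

lemma sublinear_zero:
  assumes "sublinear p"
  shows "p 0 = 0"
proof -
  have "p (2 *\<^sub>R 0) \<le> 2 * p 0" "p ((1/2) *\<^sub>R 0) \<le> (1/2) * p 0"
    using assms unfolding sublinear_def by (metis zero_less_numeral, metis half_gt_zero zero_less_one)
  then show ?thesis
    by simp
qed

lemma sublinear_scale:
  assumes "sublinear p" "c \<ge> 0"
  shows "p (c *\<^sub>R x) = c * p x"
proof (cases "c = 0")
  case True
  then show ?thesis using sublinear_zero[OF assms(1)] by simp
next
  case False
  then have c: "c > 0" using assms by simp
  have 1: "p (c *\<^sub>R x) \<le> c * p x"
    using assms c unfolding sublinear_def by blast
  have "p ((1/c) *\<^sub>R (c *\<^sub>R x)) \<le> (1/c) * p (c *\<^sub>R x)"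
    using assms c unfolding sublinear_def by (meson divide_pos_pos zero_less_one)
  then have "c * p x \<le> p (c *\<^sub>R x)"
    using c by (simp add: field_simps)
  with 1 show ?thesis by simp
qed

lemma sublinear_minus: "sublinear p \<Longrightarrow> - p (- x) \<le> p x"
  using sublinear_add[of p x "- x"] sublinear_zero[of p] by simp

text \<open>Zorn's lemma downwards: along a chain of sublinear functionals below \<open>p\<close> the pointwise infimum is
  finite, because \<open>f x \<ge> - f (- x) \<ge> - p (- x)\<close>, and it is again sublinear, because two
  members of the chain can be replaced by the smaller one.\<close>

lemma minimal_sublinear_exists:
  assumes "sublinear p"
  shows "\<exists>q. sublinear q \<and> q \<le> p \<and> (\<forall>r. sublinear r \<longrightarrow> r \<le> q \<longrightarrow> r = q)"
proof -
  let ?A = "{q. sublinear q \<and> q \<le> p}"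
  have po: "partial_order_on ?A (relation_of (\<ge>) ?A)"
    by (rule partial_order_on_relation_ofI) auto
  have ub: "\<exists>u\<in>?A. \<forall>a\<in>C. a \<ge> u" if C: "C \<in> Chains (relation_of (\<ge>) ?A)" for C
  proof (cases "C = {}")
    case True
    then show ?thesis using assms by auto
  next
    case False
    have sub: "\<And>f. f \<in> C \<Longrightarrow> sublinear f \<and> f \<le> p"
      using Chains_relation_of[OF C] by auto
    have tot: "\<And>f g. f \<in> C \<Longrightarrow> g \<in> C \<Longrightarrow> f \<le> g \<or> g \<le> f"
      using C unfolding Chains_def relation_of_def by blast
    define q where "q x = (INF f\<in>C. f x)" for x
    have bdd: "bdd_below ((\<lambda>f. f x) ` C)" for x
    proof (rule bdd_belowI2)
      fix f assume f: "f \<in> C"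
      have "- f (- x) \<le> f x" "f (- x) \<le> p (- x)"
        using sub[OF f] sublinear_minus[of f x] by (auto simp: le_fun_def)
      then show "- p (- x) \<le> f x" by linarith
    qed
    have low: "q x \<le> f x" if "f \<in> C" for f x
      unfolding q_def by (rule cINF_lower[OF bdd that])
    have gr: "b \<le> q x" if "\<And>f. f \<in> C \<Longrightarrow> b \<le> f x" for b x
      unfolding q_def by (rule cINF_greatest[OF False that])
    have "q (x + y) \<le> q x + q y" for x y
    proof -
      have "q (x + y) \<le> f x + g y" if fg: "f \<in> C" "g \<in> C" for f g
      proof -
        obtain h where h: "h \<in> C" "h \<le> f" "h \<le> g"
          using tot[OF fg] fg by blast
        have "q (x + y) \<le> h (x + y)" by (rule low[OF h(1)])
        also have "\<dots> \<le> h x + h y" using sub[OF h(1)] sublinear_add by blast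
        also have "\<dots> \<le> f x + g y" using h by (simp add: le_fun_def add_mono)
        finally show ?thesis .
      qed
      then have "q (x + y) - g y \<le> q x" if "g \<in> C" for g
        using that by (intro gr) (simp add: algebra_simps)
      then have "q (x + y) - q x \<le> q y"
        by (intro gr) (simp add: algebra_simps)
      then show ?thesis by simp
    qed
    moreover have "q (c *\<^sub>R x) \<le> c * q x" if "c > 0" for c x
    proof -
      have "q (c *\<^sub>R x) / c \<le> q x"
      proof (rule gr)
        fix f assume f: "f \<in> C"
        have "q (c *\<^sub>R x) \<le> c * f x"
          using low[OF f, of "c *\<^sub>R x"] sublinear_scale[of f c x] sub[OF f] that by simp
        then show "q (c *\<^sub>R x) / c \<le> f x"
          using that by (simp add: field_simps)
      qed
      then show ?thesis using that by (simp add: field_simps)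
    qed
    moreover have "q \<le> p"
    proof -
      obtain f where f: "f \<in> C" using False by blast
      then show ?thesis
        using sub[OF f] low[OF f] by (force simp: le_fun_def intro: order_trans)
    qed
    ultimately show ?thesis
      using low by (intro bexI[of _ q]) (auto simp: sublinear_def le_fun_def)
  qed
  from predicate_Zorn[OF po ub] obtain m where "m \<in> ?A" "\<forall>a\<in>?A. a \<le> m \<longrightarrow> a = m"
    by blast
  then show ?thesis
    by (intro exI[of _ m]) (auto intro: order_trans)
qed

text \<open>For fixed \<open>y\<close>, the infimum \<open>r x\<close> of \<open>q (x + t y) - t q y\<close> over \<open>t \<ge> 0\<close> is a sublinear functional below \<open>q\<close>. Minimality
  gives \<open>r = q\<close>, and the choice \<open>t = 1\<close> turns this into superadditivity of \<open>q\<close>.\<close>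

lemma minimal_sublinear_linear:
  assumes q: "sublinear q" and min: "\<And>r. sublinear r \<Longrightarrow> r \<le> q \<Longrightarrow> r = q"
  shows "linear q"
proof -
  have super: "q x + q y \<le> q (x + y)" for x y
  proof -
    define r where "r z = (INF t\<in>{0..}. q (z + t *\<^sub>R y) - t * q y)" for z
    have bdd: "bdd_below ((\<lambda>t. q (z + t *\<^sub>R y) - t * q y) ` {0..})" for z
    proof (rule bdd_belowI2)
      fix t :: real assume "t \<in> {0..}"
      then show "- q (- z) \<le> q (z + t *\<^sub>R y) - t * q y"
        using sublinear_add[OF q, of "z + t *\<^sub>R y" "- z"] sublinear_scale[OF q, of t y] by simp
    qed
    have low: "r z \<le> q (z + t *\<^sub>R y) - t * q y" if "t \<ge> 0" for t z
      unfolding r_def using that by (intro cINF_lower[OF bdd]) simp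
    have gr: "b \<le> r z" if "\<And>t. t \<ge> 0 \<Longrightarrow> b \<le> q (z + t *\<^sub>R y) - t * q y" for b :: real and z
      unfolding r_def using that by (intro cINF_greatest) auto
    have "r (z + w) \<le> r z + r w" for z w
    proof -
      have *: "r (z + w) \<le> (q (z + t *\<^sub>R y) - t * q y) + (q (w + s *\<^sub>R y) - s * q y)"
        if "t \<ge> 0" "s \<ge> 0" for t s
      proof -
        have "r (z + w) \<le> q (z + w + (t + s) *\<^sub>R y) - (t + s) * q y"
          using that by (intro low) simp
        also have "z + w + (t + s) *\<^sub>R y = (z + t *\<^sub>R y) + (w + s *\<^sub>R y)"
          by (simp add: algebra_simps)
        also have "q \<dots> - (t + s) * q y \<le> q (z + t *\<^sub>R y) + q (w + s *\<^sub>R y) - (t + s) * q y"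
          using sublinear_add[OF q] by simp
        finally show ?thesis by (simp add: algebra_simps)
      qed
      have "r (z + w) - (q (w + s *\<^sub>R y) - s * q y) \<le> r z" if "s \<ge> 0" for s
        by (rule gr) (use *[OF _ that] in \<open>simp add: algebra_simps\<close>)
      then have "r (z + w) - r z \<le> r w"
        by (intro gr) (simp add: algebra_simps)
      then show ?thesis by simp
    qed
    moreover have "r (c *\<^sub>R z) \<le> c * r z" if c: "c > 0" for c z
    proof -
      have "r (c *\<^sub>R z) / c \<le> r z"
      proof (rule gr)
        fix t :: real assume t: "t \<ge> 0"
        have "r (c *\<^sub>R z) \<le> q (c *\<^sub>R z + (c * t) *\<^sub>R y) - (c * t) * q y"
          using c t by (intro low) simp
        also have "c *\<^sub>R z + (c * t) *\<^sub>R y = c *\<^sub>R (z + t *\<^sub>R y)"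
          by (simp add: algebra_simps)
        also have "q \<dots> = c * q (z + t *\<^sub>R y)"
          using c by (intro sublinear_scale[OF q]) simp
        finally show "r (c *\<^sub>R z) / c \<le> q (z + t *\<^sub>R y) - t * q y"
          using c by (simp add: field_simps)
      qed
      then show ?thesis using c by (simp add: field_simps)
    qed
    ultimately have "sublinear r"
      by (simp add: sublinear_def)
    moreover have "r \<le> q"
      using low[of 0] by (simp add: le_fun_def)
    ultimately have "r = q" by (rule min)
    then show ?thesis using low[of 1 x] by simp
  qed
  have add: "q (x + y) = q x + q y" for x y
    using super[of x y] sublinear_add[OF q, of x y] by simp
  have neg: "q (- x) = - q x" for x
    using add[of x "- x"] sublinear_zero[OF q] by simp
  have "q (c *\<^sub>R x) = c *\<^sub>R q x" for c x
  proof (cases "c \<ge> 0")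
    case True
    then show ?thesis using sublinear_scale[OF q] by simp
  next
    case False
    then show ?thesis
      using sublinear_scale[OF q, of "- c" x] neg[of "c *\<^sub>R x"] by simp
  qed
  with add show ?thesis by (rule linearI)
qed

text \<open>The Hahn--Banach theorem without a subspace to extend from: the functionals needed below are all
  produced by choosing a suitable \<open>p\<close>.\<close>

theorem hahn_banach_dominated:
  assumes "sublinear p"
  shows "\<exists>f. linear f \<and> (\<forall>x. f x \<le> p x)"
  using minimal_sublinear_exists[OF assms] minimal_sublinear_linear
  by (metis le_funD)

lemma hahn_banach_dual:
  fixes p :: "'a::real_normed_vector \<Rightarrow> real"
  assumes "sublinear p" and bound: "\<And>x. p x \<le> M * norm x"
  shows "\<exists>\<xi> :: 'a dual. \<forall>x. \<xi> x \<le> p x"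
proof -
  obtain f where f: "linear f" "\<And>x. f x \<le> p x"
    using hahn_banach_dominated[OF assms(1)] by blast
  have "\<bar>f x\<bar> \<le> norm x * M" for x
    using f(2)[of x] bound[of x] f(2)[of "- x"] bound[of "- x"] linear_neg[OF f(1), of x]
    by (simp add: mult.commute abs_le_iff)
  then have "bounded_linear f"
    using f(1) by (intro bounded_linear_intro[of f M])
      (auto simp: linear_add linear_cmul mult.commute)
  then show ?thesis
    using f(2) by (intro exI[of _ "Blinfun f"]) (simp add: bounded_linear_Blinfun_apply)
qed

section \<open>Separation and reflexivity\<close>

text \<open>If \<open>d\<close> is a positive lower bound for the distance from \<open>x\<close> to \<open>C\<close>, then the infimum \<open>p z\<close> of
  \<open>norm (z + t (c - x)) - t d\<close> over \<open>t \<ge> 0\<close> and \<open>c \<in> C\<close> is sublinear and satisfies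
  \<open>- norm z \<le> p z \<le> norm z\<close> as well as \<open>p (x - c) \<le> - d\<close>. Every linear functional below \<open>p\<close>
  therefore separates.\<close>

lemma separate_point_closed_convex:
  fixes C :: "'a::real_normed_vector set"
  assumes C: "closed C" "convex C" "C \<noteq> {}" and x: "x \<notin> C"
  shows "\<exists>(\<xi> :: 'a dual) d. d > 0 \<and> (\<forall>c\<in>C. \<xi> x + d \<le> \<xi> c)"
proof -
  obtain d where d: "d > 0" "\<And>c. c \<in> C \<Longrightarrow> d \<le> norm (c - x)"
  proof -
    have "\<exists>e>0. ball x e \<subseteq> - C"
      using C(1) x open_contains_ball[of "- C"] by auto
    then obtain e where "e > 0" "ball x e \<subseteq> - C" by blast
    then show ?thesis
      by (intro that[of e]) (auto simp: subset_iff dist_norm norm_minus_commute not_less[symmetric])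
  qed
  define p where "p z = (INF tc\<in>{0::real..}\<times>C. norm (z + fst tc *\<^sub>R (snd tc - x)) - fst tc * d)" for z :: 'a
  have bdd: "bdd_below ((\<lambda>tc. norm (z + fst tc *\<^sub>R (snd tc - x)) - fst tc * d) ` ({0::real..} \<times> C))" for z
  proof (rule bdd_belowI2)
    fix tc :: "real \<times> 'a" assume "tc \<in> {0..} \<times> C"
    then obtain t c where tc: "tc = (t, c)" "t \<ge> 0" "c \<in> C" by auto
    have "t * d \<le> norm (t *\<^sub>R (c - x))"
      using d(2)[OF tc(3)] tc(2) by (simp add: mult_left_mono)
    also have "\<dots> \<le> norm (z + t *\<^sub>R (c - x)) + norm z"
      using norm_triangle_ineq4[of "z + t *\<^sub>R (c - x)" z] by simp
    finally show "- norm z \<le> norm (z + fst tc *\<^sub>R (snd tc - x)) - fst tc * d"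
      by (simp add: tc)
  qed
  have low: "p z \<le> norm (z + t *\<^sub>R (c - x)) - t * d" if "t \<ge> 0" "c \<in> C" for t :: real and c z
    unfolding p_def using cINF_lower[OF bdd, of "(t, c)" z] that by simp
  have gr: "b \<le> p z" if "\<And>(t::real) c. t \<ge> 0 \<Longrightarrow> c \<in> C \<Longrightarrow> b \<le> norm (z + t *\<^sub>R (c - x)) - t * d" for b :: real and z
    unfolding p_def using that C(3) by (intro cINF_greatest) auto
  have "p (z + w) \<le> p z + p w" for z w
  proof -
    have *: "p (z + w) \<le> (norm (z + t *\<^sub>R (c - x)) - t * d) + (norm (w + s *\<^sub>R (e - x)) - s * d)"
      if ts: "t \<ge> 0" "s \<ge> 0" and ce: "c \<in> C" "e \<in> C" for t s :: real and c e
    proof -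
      \<comment> \<open>the cone spanned by \<open>C - x\<close> is closed under addition\<close>
      obtain b where b: "b \<in> C" "(t + s) *\<^sub>R (b - x) = t *\<^sub>R (c - x) + s *\<^sub>R (e - x)"
      proof (cases "t + s = 0")
        case True
        with ts have "t = 0" "s = 0" by auto
        with ce that show ?thesis by simp
      next
        case False
        let ?b = "(t / (t + s)) *\<^sub>R c + (s / (t + s)) *\<^sub>R e"
        have "?b \<in> C"
          using ts ce False by (intro convexD[OF C(2)]) (auto simp: add_divide_distrib[symmetric])
        moreover have "(t + s) *\<^sub>R (?b - x) = t *\<^sub>R (c - x) + s *\<^sub>R (e - x)"
          using False by (simp add: scaleR_add_right scaleR_diff_right scaleR_add_left)
        ultimately show ?thesis using that by blast
      qed
      have "p (z + w) \<le> norm (z + w + (t + s) *\<^sub>R (b - x)) - (t + s) * d"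
        using ts b by (intro low) auto
      also have "z + w + (t + s) *\<^sub>R (b - x) = (z + t *\<^sub>R (c - x)) + (w + s *\<^sub>R (e - x))"
        unfolding b(2) by (simp only: add_ac)
      also have "norm \<dots> - (t + s) * d \<le> norm (z + t *\<^sub>R (c - x)) + norm (w + s *\<^sub>R (e - x)) - (t + s) * d"
        using norm_triangle_ineq by (intro diff_right_mono) blast
      finally show ?thesis by (simp add: algebra_simps)
    qed
    have "p (z + w) - (norm (w + s *\<^sub>R (e - x)) - s * d) \<le> p z" if "s \<ge> 0" "e \<in> C" for s e
      by (rule gr) (use *[OF _ that(1) _ that(2)] in \<open>simp add: algebra_simps\<close>)
    then have "p (z + w) - p z \<le> p w"
      by (intro gr) (simp add: algebra_simps)
    then show ?thesis by simp
  qed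
  moreover have "p (c *\<^sub>R z) \<le> c * p z" if c: "c > 0" for c z
  proof -
    have "p (c *\<^sub>R z) / c \<le> p z"
    proof (rule gr)
      fix t :: real and e assume t: "t \<ge> 0" "e \<in> C"
      have "p (c *\<^sub>R z) \<le> norm (c *\<^sub>R z + (c * t) *\<^sub>R (e - x)) - (c * t) * d"
        using c t by (intro low) auto
      also have "c *\<^sub>R z + (c * t) *\<^sub>R (e - x) = c *\<^sub>R (z + t *\<^sub>R (e - x))"
        by (simp add: algebra_simps)
      also have "norm \<dots> = c * norm (z + t *\<^sub>R (e - x))"
        using c by simp
      finally show "p (c *\<^sub>R z) / c \<le> norm (z + t *\<^sub>R (e - x)) - t * d"
        using c by (simp add: field_simps)
    qed
    then show ?thesis using c by (simp add: field_simps)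
  qed
  ultimately have "sublinear p"
    by (simp add: sublinear_def)
  moreover have "p z \<le> 1 * norm z" for z
    using low[of 0 _ z] C(3) by auto
  ultimately obtain \<xi> :: "'a dual" where \<xi>: "\<And>z. \<xi> z \<le> p z"
    using hahn_banach_dual by blast
  have "\<xi> x + d \<le> \<xi> c" if c: "c \<in> C" for c
    using \<xi>[of "x - c"] low[of 1 c "x - c"] c by (simp add: blinfun.diff_right)
  with d(1) show ?thesis by blast
qed

text \<open>This replaces weak compactness. On the dual, \<open>p \<xi>\<close> is the infimum over the family of the support
  functions of its members; directedness makes \<open>p\<close> subadditive. A linear functional below \<open>p\<close> is, by
  reflexivity, evaluation at a point \<open>x\<close>. Since \<open>\<xi> x\<close> never exceeds the support function of a member,
  separation puts \<open>x\<close> into each of them.\<close>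

lemma reflexive_directed_Inter:
  fixes \<C> :: "'a::real_normed_vector set set"
  assumes refl: "reflexive_space TYPE('a)"
    and ne: "\<C> \<noteq> {}"
    and mem: "\<And>C. C \<in> \<C> \<Longrightarrow> closed C \<and> convex C \<and> C \<noteq> {} \<and> bounded C"
    and dir: "\<And>C D. C \<in> \<C> \<Longrightarrow> D \<in> \<C> \<Longrightarrow> \<exists>B\<in>\<C>. B \<subseteq> C \<inter> D"
  shows "\<Inter>\<C> \<noteq> {}"
proof -
  obtain C0 where C0: "C0 \<in> \<C>" using ne by blast
  obtain M where M: "\<And>x. x \<in> C0 \<Longrightarrow> norm x \<le> M"
    using mem[OF C0] by (auto simp: bounded_iff)
  define h where "h C \<xi> = (SUP x\<in>C. blinfun_apply \<xi> x)" for C :: "'a set" and \<xi> :: "'a dual"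
  have bdd: "bdd_above (blinfun_apply \<xi> ` C)" if C: "C \<in> \<C>" for C and \<xi> :: "'a dual"
  proof -
    have "bounded (blinfun_apply \<xi> ` C)"
      using mem[OF C] blinfun.bounded_linear_right bounded_linear_image by blast
    then obtain B where "\<And>x. x \<in> C \<Longrightarrow> \<bar>\<xi> x\<bar> \<le> B" by (auto simp: bounded_iff)
    then show ?thesis by (intro bdd_aboveI2[of _ _ B]) (auto simp: abs_le_iff)
  qed
  have hu: "\<xi> x \<le> h C \<xi>" if "C \<in> \<C>" "x \<in> C" for C x and \<xi> :: "'a dual"
    unfolding h_def by (rule cSUP_upper[OF that(2) bdd[OF that(1)]])
  have hl: "h C \<xi> \<le> b" if "C \<in> \<C>" "\<And>x. x \<in> C \<Longrightarrow> \<xi> x \<le> b" for C b and \<xi> :: "'a dual"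
    unfolding h_def using mem[OF that(1)] that(2) by (intro cSUP_least) auto
  have lower: "- (M * norm \<xi>) \<le> h C \<xi>" if C: "C \<in> \<C>" for C and \<xi> :: "'a dual"
  proof -
    obtain B where B: "B \<in> \<C>" "B \<subseteq> C0 \<inter> C" using dir[OF C0 C] by blast
    obtain x where x: "x \<in> B" using mem[OF B(1)] by blast
    have "\<bar>\<xi> x\<bar> \<le> norm \<xi> * norm x"
      using norm_blinfun[of \<xi> x] by simp
    also have "\<dots> \<le> norm \<xi> * M"
      using M[of x] x B by (intro mult_left_mono) auto
    finally have "- (M * norm \<xi>) \<le> \<xi> x" by (simp add: mult.commute abs_le_iff)
    also have "\<dots> \<le> h C \<xi>" using hu[OF C] x B by blast
    finally show ?thesis .
  qed
  define p where "p \<xi> = (INF C\<in>\<C>. h C \<xi>)" for \<xi>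
  have pl: "p \<xi> \<le> h C \<xi>" if "C \<in> \<C>" for C and \<xi> :: "'a dual"
    unfolding p_def by (rule cINF_lower[OF _ that]) (use lower in \<open>auto intro!: bdd_belowI2\<close>)
  have pg: "b \<le> p \<xi>" if "\<And>C. C \<in> \<C> \<Longrightarrow> b \<le> h C \<xi>" for b and \<xi> :: "'a dual"
    unfolding p_def by (rule cINF_greatest[OF ne that])
  have "p (\<xi> + \<eta>) \<le> p \<xi> + p \<eta>" for \<xi> \<eta>
  proof -
    have *: "p (\<xi> + \<eta>) \<le> h C \<xi> + h D \<eta>" if CD: "C \<in> \<C>" "D \<in> \<C>" for C D
    proof -
      obtain B where B: "B \<in> \<C>" "B \<subseteq> C \<inter> D" using dir[OF CD] by blast
      have "p (\<xi> + \<eta>) \<le> h B (\<xi> + \<eta>)" by (rule pl[OF B(1)])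
      also have "\<dots> \<le> h C \<xi> + h D \<eta>"
        by (rule hl[OF B(1)]) (use B CD hu in \<open>auto simp: blinfun.add_left intro!: add_mono\<close>)
      finally show ?thesis .
    qed
    have "p (\<xi> + \<eta>) - h D \<eta> \<le> p \<xi>" if "D \<in> \<C>" for D
      by (rule pg) (use *[OF _ that] in \<open>simp add: algebra_simps\<close>)
    then have "p (\<xi> + \<eta>) - p \<xi> \<le> p \<eta>"
      by (intro pg) (simp add: algebra_simps)
    then show ?thesis by simp
  qed
  moreover have "p (c *\<^sub>R \<xi>) \<le> c * p \<xi>" if c: "c > 0" for c \<xi>
  proof -
    have "p (c *\<^sub>R \<xi>) / c \<le> p \<xi>"
    proof (rule pg)
      fix C assume C: "C \<in> \<C>"
      have "p (c *\<^sub>R \<xi>) \<le> h C (c *\<^sub>R \<xi>)" by (rule pl[OF C])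
      also have "\<dots> \<le> c * h C \<xi>"
        by (rule hl[OF C]) (use hu[OF C] c in \<open>auto simp: blinfun.scaleR_left intro!: mult_left_mono\<close>)
      finally show "p (c *\<^sub>R \<xi>) / c \<le> h C \<xi>"
        using c by (simp add: field_simps)
    qed
    then show ?thesis using c by (simp add: field_simps)
  qed
  ultimately have "sublinear p"
    by (simp add: sublinear_def)
  moreover have "p \<xi> \<le> M * norm \<xi>" for \<xi>
  proof -
    have "\<xi> x \<le> M * norm \<xi>" if "x \<in> C0" for x
    proof -
      have "\<xi> x \<le> norm \<xi> * norm x"
        using norm_blinfun[of \<xi> x] by simp
      also have "\<dots> \<le> norm \<xi> * M"
        using M[OF that] by (intro mult_left_mono) auto
      finally show ?thesis by (simp add: mult.commute)
    qed
    then have "h C0 \<xi> \<le> M * norm \<xi>" by (rule hl[OF C0])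
    with pl[OF C0, of \<xi>] show ?thesis by linarith
  qed
  ultimately obtain \<Phi> :: "'a dual dual" where \<Phi>: "\<And>\<xi>. \<Phi> \<xi> \<le> p \<xi>"
    using hahn_banach_dual by blast
  obtain x where x: "\<And>\<xi> :: 'a dual. \<Phi> \<xi> = \<xi> x"
    using refl unfolding reflexive_space_def by blast
  have "x \<in> C" if C: "C \<in> \<C>" for C
  proof (rule ccontr)
    assume "x \<notin> C"
    then obtain \<eta> :: "'a dual" and d where \<eta>: "d > 0" "\<And>c. c \<in> C \<Longrightarrow> \<eta> x + d \<le> \<eta> c"
      using separate_point_closed_convex[of C x] mem[OF C] by blast
    define \<xi> where "\<xi> = - \<eta>"
    have d: "d > 0" "\<And>c. c \<in> C \<Longrightarrow> \<xi> c + d \<le> \<xi> x"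
      using \<eta> by (force simp: \<xi>_def blinfun.minus_left algebra_simps)+
    have "\<xi> x \<le> h C \<xi>" using \<Phi>[of \<xi>] pl[OF C, of \<xi>] x[of \<xi>] by simp
    also have "\<dots> \<le> \<xi> x - d"
      using d(2) by (intro hl[OF C]) (simp add: algebra_simps)
    finally show False using d(1) by simp
  qed
  then show ?thesis by blast
qed

section \<open>Systems of convex inequalities\<close>

text \<open>The pairs strictly above some value \<open>(f u, g u)\<close> form a convex set in the plane that misses the
  origin. A line through the origin bounding this set has a normal with nonnegative components, since
  the set is closed under increasing either coordinate; normalized, they are the weights.\<close>

lemma convex_alternative_pair:
  fixes f g :: "'a::real_vector \<Rightarrow> real"
  assumes f: "convex_on C f" and g: "convex_on C g"
    and no: "\<And>u. u \<in> C \<Longrightarrow> f u < 0 \<Longrightarrow> g u < 0 \<Longrightarrow> False"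
  shows "\<exists>a b. a \<ge> 0 \<and> b \<ge> 0 \<and> a + b = 1 \<and> (\<forall>u\<in>C. 0 \<le> a * f u + b * g u)"
proof -
  define S where "S = {(s, t). \<exists>u\<in>C. f u < s \<and> g u < t}"
  have "convex S"
  proof (rule convexI)
    fix x y :: "real \<times> real" and a b :: real
    assume xy: "x \<in> S" "y \<in> S" and ab: "0 \<le> a" "0 \<le> b" "a + b = 1"
    obtain u where u: "u \<in> C" "f u < fst x" "g u < snd x" using xy(1) by (auto simp: S_def)
    obtain v where v: "v \<in> C" "f v < fst y" "g v < snd y" using xy(2) by (auto simp: S_def)
    have mono: "a * s + b * t < a * s' + b * t'" if "s < s'" "t < t'" for s t s' t'
    proof (cases "a = 0")
      case True
      with ab that show ?thesis by simp
    next
      case False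
      then show ?thesis
        using that ab by (intro add_less_le_mono mult_strict_left_mono mult_left_mono) auto
    qed
    let ?w = "a *\<^sub>R u + b *\<^sub>R v"
    have "?w \<in> C" using f u v ab by (auto simp: convex_on_def convex_def)
    moreover have "f ?w < a * fst x + b * fst y"
    proof -
      have "f ?w \<le> a * f u + b * f v" using f u v ab by (simp add: convex_on_def)
      with mono[OF u(2) v(2)] show ?thesis by linarith
    qed
    moreover have "g ?w < a * snd x + b * snd y"
    proof -
      have "g ?w \<le> a * g u + b * g v" using g u v ab by (simp add: convex_on_def)
      with mono[OF u(3) v(3)] show ?thesis by linarith
    qed
    ultimately show "a *\<^sub>R x + b *\<^sub>R y \<in> S"
      by (auto simp: S_def split_beta)
  qed
  moreover have "0 \<notin> S" using no by (auto simp: S_def zero_prod_def)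
  ultimately obtain n where n: "n \<noteq> 0" "\<And>x. x \<in> S \<Longrightarrow> 0 \<le> n \<bullet> x"
    using separating_hyperplane_set_0[of S] by blast
  obtain a b where ab: "n = (a, b)" by (cases n)
  have pos: "0 \<le> a * (f u + s) + b * (g u + t)" if "u \<in> C" "s > 0" "t > 0" for u s t
    using n(2)[of "(f u + s, g u + t)"] that by (force simp: S_def ab)
  show ?thesis
  proof (cases "C = {}")
    case True
    then show ?thesis by (intro exI[of _ 1] exI[of _ 0]) simp
  next
    case False
    then obtain u0 where u0: "u0 \<in> C" by blast
    \<comment> \<open>an amount large enough for \<open>(f u0, g u0)\<close>, moved up in one coordinate by \<open>r\<close> divided by the
      modulus of a negative weight, to land on the wrong side of the line\<close>
    define r where "r = \<bar>a * f u0\<bar> + \<bar>b * g u0\<bar> + \<bar>a\<bar> + \<bar>b\<bar> + 1"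
    have r: "r > 0" by (simp add: r_def)
    have a: "a \<ge> 0"
    proof (rule ccontr)
      assume "\<not> a \<ge> 0"
      then have "a < 0" by simp
      have "0 \<le> a * (f u0 + r / (- a)) + b * (g u0 + 1)"
        using \<open>a < 0\<close> r by (intro pos[OF u0] divide_pos_pos) auto
      also have "\<dots> = a * f u0 + b * g u0 + b - r"
        using \<open>a < 0\<close> by (simp add: field_simps)
      finally show False unfolding r_def by linarith
    qed
    have b: "b \<ge> 0"
    proof (rule ccontr)
      assume "\<not> b \<ge> 0"
      then have "b < 0" by simp
      have "0 \<le> a * (f u0 + 1) + b * (g u0 + r / (- b))"
        using \<open>b < 0\<close> r by (intro pos[OF u0] divide_pos_pos) auto
      also have "\<dots> = a * f u0 + b * g u0 + a - r"
        using \<open>b < 0\<close> by (simp add: field_simps)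
      finally show False unfolding r_def by linarith
    qed
    have s: "a + b > 0" using a b n(1) ab by (auto simp: zero_prod_def add_nonneg_eq_0_iff order_less_le)
    have main: "0 \<le> a * f u + b * g u" if u: "u \<in> C" for u
    proof (rule field_le_epsilon)
      fix e :: real assume e: "e > 0"
      have "0 \<le> a * (f u + e / (a + b)) + b * (g u + e / (a + b))"
        using e s by (intro pos[OF u]) auto
      also have "\<dots> = a * f u + b * g u + (a + b) * (e / (a + b))"
        by (simp only: algebra_simps)
      also have "(a + b) * (e / (a + b)) = e"
        using s by simp
      finally show "0 \<le> a * f u + b * g u + e" .
    qed
    have "0 \<le> (a / (a + b)) * f u + (b / (a + b)) * g u" if "u \<in> C" for u
    proof -
      have "(a / (a + b)) * f u + (b / (a + b)) * g u = (a * f u + b * g u) / (a + b)"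
        by (simp add: add_divide_distrib)
      then show ?thesis using main[OF that] s by simp
    qed
    moreover have "a / (a + b) + b / (a + b) = 1"
      using s by (simp add: add_divide_distrib[symmetric])
    ultimately show ?thesis
      using a b s by (intro exI[of _ "a / (a + b)"] exI[of _ "b / (a + b)"]) auto
  qed
qed

lemma convex_on_weighted_sum:
  assumes "convex C" "\<And>v. v \<in> V \<Longrightarrow> convex_on C (f v)" "\<And>v. v \<in> V \<Longrightarrow> w v \<ge> (0::real)"
  shows "convex_on C (\<lambda>u. \<Sum>v\<in>V. w v * f v u)"
  using assms(2,3)
proof (induction V rule: infinite_finite_induct)
  case (insert v V)
  then show ?case by (auto intro!: convex_on_add convex_on_cmul)
qed (use assms(1) in \<open>auto simp: convex_on_def\<close>)

text \<open>A finite-dimensional minimax theorem. For the inductive step the weights of the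
  remaining functions are found on the convex set where the new function is negative; their combination
  and the new function then have no common point of negativity, and the case of two functions applies.\<close>

lemma convex_alternative:
  fixes f :: "'i \<Rightarrow> 'a::real_vector \<Rightarrow> real"
  assumes "finite V" "V \<noteq> {}"
    and "\<And>v. v \<in> V \<Longrightarrow> convex_on C (f v)"
    and "\<And>u. u \<in> C \<Longrightarrow> \<exists>v\<in>V. 0 \<le> f v u"
  shows "\<exists>w. (\<forall>v\<in>V. w v \<ge> 0) \<and> sum w V = 1 \<and> (\<forall>u\<in>C. 0 \<le> (\<Sum>v\<in>V. w v * f v u))"
  using assms
proof (induction V arbitrary: C rule: finite_ne_induct)
  case (singleton v)
  then show ?case by (intro exI[of _ "\<lambda>_. 1"]) auto
next
  case (insert v V)
  let ?D = "{u \<in> C. f v u < 0}"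
  have cv: "convex_on C (f v)" using insert.prems by simp
  then have C: "convex C" by (simp add: convex_on_def)
  have D: "convex ?D"
  proof (rule convexI)
    fix x y and a b :: real
    assume xy: "x \<in> ?D" "y \<in> ?D" and ab: "0 \<le> a" "0 \<le> b" "a + b = 1"
    have "f v (a *\<^sub>R x + b *\<^sub>R y) \<le> a * f v x + b * f v y"
      using cv xy ab by (simp add: convex_on_def)
    also have "\<dots> < 0"
      using convex_bound_lt[of "f v x" 0 "f v y" a b] xy ab by simp
    finally show "a *\<^sub>R x + b *\<^sub>R y \<in> ?D"
      using C xy ab by (auto simp: convex_def)
  qed
  have "\<exists>w. (\<forall>v\<in>V. w v \<ge> 0) \<and> sum w V = 1 \<and> (\<forall>u\<in>?D. 0 \<le> (\<Sum>v\<in>V. w v * f v u))"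
  proof (rule insert.IH)
    show "convex_on ?D (f i)" if "i \<in> V" for i
      using that insert.prems(1)[of i] D by (auto intro: convex_on_subset)
    show "\<exists>v\<in>V. 0 \<le> f v u" if "u \<in> ?D" for u
      using insert.prems(2)[of u] that by auto
  qed
  then obtain w where w: "\<And>i. i \<in> V \<Longrightarrow> w i \<ge> 0" "sum w V = 1"
      "\<And>u. u \<in> ?D \<Longrightarrow> 0 \<le> (\<Sum>v\<in>V. w v * f v u)"
    by blast
  have "convex_on C (\<lambda>u. \<Sum>v\<in>V. w v * f v u)"
    using C insert.prems(1) w(1) by (intro convex_on_weighted_sum) auto
  moreover have "\<not> (\<Sum>v\<in>V. w v * f v u) < 0" if "u \<in> C" "f v u < 0" for u
    using w(3)[of u] that by simp
  ultimately have "\<exists>a b. a \<ge> 0 \<and> b \<ge> 0 \<and> a + b = 1 \<and>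
      (\<forall>u\<in>C. 0 \<le> a * f v u + b * (\<Sum>v\<in>V. w v * f v u))"
    by (intro convex_alternative_pair[OF cv]) auto
  then obtain a b where ab: "a \<ge> 0" "b \<ge> 0" "a + b = 1"
      "\<And>u. u \<in> C \<Longrightarrow> 0 \<le> a * f v u + b * (\<Sum>v\<in>V. w v * f v u)"
    by blast
  have nv: "i \<noteq> v" if "i \<in> V" for i using that insert.hyps by blast
  define w' where "w' i = (if i = v then a else b * w i)" for i
  have "sum w' V = (\<Sum>i\<in>V. b * w i)"
    using nv by (intro sum.cong) (auto simp: w'_def)
  also have "\<dots> = b"
    using w(2) by (simp flip: sum_distrib_left)
  finally have 1: "sum w' (insert v V) = 1"
    using insert.hyps ab(3) by (simp add: w'_def)
  have 2: "(\<Sum>i\<in>insert v V. w' i * f i u) = a * f v u + b * (\<Sum>i\<in>V. w i * f i u)" for u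
  proof -
    have "(\<Sum>i\<in>V. w' i * f i u) = (\<Sum>i\<in>V. b * (w i * f i u))"
      using nv by (intro sum.cong) (auto simp: w'_def)
    then show ?thesis
      using insert.hyps by (simp add: w'_def sum_distrib_left)
  qed
  have "\<forall>i\<in>insert v V. w' i \<ge> 0"
    using ab w(1) by (auto simp: w'_def)
  moreover have "\<forall>u\<in>C. 0 \<le> (\<Sum>i\<in>insert v V. w' i * f i u)"
    unfolding 2 using ab(4) by blast
  ultimately show ?case using 1 by blast
qed

section \<open>Convex and lower semicontinuous functions\<close>

lemma lsc_on_add_continuous:
  fixes g h :: "'a::metric_space \<Rightarrow> real"
  assumes g: "lsc_on S g" and h: "continuous_on S h"
  shows "lsc_on S (\<lambda>x. g x + h x)"
  unfolding lsc_on_def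
proof (intro ballI allI impI)
  fix x c assume x: "x \<in> S" and c: "c < g x + h x"
  define e where "e = (g x + h x - c) / 2"
  have e: "e > 0" using c by (simp add: e_def)
  have "\<forall>\<^sub>F y in at x within S. g x - e < g y"
    using g x e by (simp add: lsc_on_def)
  moreover have "\<forall>\<^sub>F y in at x within S. h x - e < h y"
    using h x e order_tendstoD(1)[of h "h x" "at x within S" "h x - e"]
    by (simp add: continuous_on_def)
  ultimately show "\<forall>\<^sub>F y in at x within S. c < g y + h y"
    by eventually_elim (simp add: e_def field_simps)
qed

lemma closed_lsc_sublevel:
  fixes g :: "'a::metric_space \<Rightarrow> real"
  assumes S: "closed S" and g: "lsc_on S g"
  shows "closed {x \<in> S. g x \<le> c}"
  unfolding closed_limpt
proof (intro allI impI)
  fix x assume x: "x islimpt {x \<in> S. g x \<le> c}"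
  then have xS: "x \<in> S"
    using S islimpt_subset[OF x, of S] by (auto simp: closed_limpt)
  have "g x \<le> c"
  proof (rule ccontr)
    assume "\<not> g x \<le> c"
    then have "\<forall>\<^sub>F y in at x within S. c < g y"
      using g xS by (simp add: lsc_on_def)
    then have "\<forall>\<^sub>F y in at x. y \<in> S \<longrightarrow> c < g y"
      by (auto simp: eventually_at_filter elim: eventually_mono)
    moreover have "\<exists>\<^sub>F y in at x. y \<in> {x \<in> S. g x \<le> c}"
      using x by (simp add: islimpt_conv_frequently_at)
    ultimately have "\<exists>\<^sub>F y in at x. y \<in> {x \<in> S. g x \<le> c} \<and> (y \<in> S \<longrightarrow> c < g y)"
      by (rule frequently_eventually_frequently[rotated])
    then show False by (auto dest!: frequently_ex)
  qed
  with xS show "x \<in> {x \<in> S. g x \<le> c}" by simp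
qed

text \<open>Lower semicontinuity bounds \<open>h\<close> from below on a small ball around \<open>x\<close>; convexity along the segment
  from \<open>x\<close> to a distant \<open>u\<close> carries this bound outwards with linear growth.\<close>

lemma convex_lsc_affine_minorant:
  fixes h :: "'a::real_normed_vector \<Rightarrow> real"
  assumes h: "convex_on K h" "lsc_on K h" and x: "x \<in> K"
  shows "\<exists>b\<ge>0. \<forall>u\<in>K. h x - 1 - b * norm (u - x) \<le> h u"
proof -
  have "\<forall>\<^sub>F y in at x within K. h x - 1 < h y"
    using h(2) x by (simp add: lsc_on_def)
  then obtain d where d: "d > 0" "\<And>y. y \<in> K \<Longrightarrow> y \<noteq> x \<Longrightarrow> dist y x < d \<Longrightarrow> h x - 1 < h y"
    unfolding eventually_at by blast
  define r where "r = d / 2"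
  have r: "r > 0" "\<And>y. y \<in> K \<Longrightarrow> norm (y - x) \<le> r \<Longrightarrow> h x - 1 \<le> h y"
  proof -
    show "r > 0" using d(1) by (simp add: r_def)
    show "h x - 1 \<le> h y" if "y \<in> K" "norm (y - x) \<le> r" for y
      using d(2)[OF that(1)] that(2) d(1) by (cases "y = x") (auto simp: r_def dist_norm)
  qed
  have "h x - 1 - (1 / r) * norm (u - x) \<le> h u" if u: "u \<in> K" for u
  proof (cases "norm (u - x) \<le> r")
    case True
    have "0 \<le> (1 / r) * norm (u - x)" using r(1) by simp
    with r(2)[OF u True] show ?thesis by linarith
  next
    case False
    define t where "t = r / norm (u - x)"
    have n: "norm (u - x) > 0" using False r(1) by linarith
    have t: "0 < t" "t \<le> 1" using False r(1) n by (auto simp: t_def)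
    have tn: "t * norm (u - x) = r" using n by (simp add: t_def)
    let ?w = "(1 - t) *\<^sub>R x + t *\<^sub>R u"
    have "?w \<in> K"
      using h(1) x u t by (auto simp: convex_on_def convex_def)
    moreover have "?w - x = t *\<^sub>R (u - x)" by (simp add: algebra_simps)
    then have "norm (?w - x) \<le> r" using t tn by simp
    ultimately have "h x - 1 \<le> h ?w" by (rule r(2))
    also have "\<dots> \<le> (1 - t) * h x + t * h u"
      using t by (intro convex_onD[OF h(1) _ _ x u]) auto
    finally have *: "t * h x - 1 \<le> t * h u" by (simp add: algebra_simps)
    have "h x - 1 / t \<le> h u" using * t(1) by (simp add: field_simps)
    moreover have "1 / t = (1 / r) * norm (u - x)" by (simp add: t_def)
    ultimately show ?thesis by linarith
  qed
  then show ?thesis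
    using r(1) by (intro exI[of _ "1 / r"]) auto
qed

text \<open>A quadratic term dominates the at most linear decrease of a convex lower semicontinuous function.\<close>

lemma bounded_sublevel_quadratic:
  fixes h :: "'a::real_normed_vector \<Rightarrow> real"
  assumes h: "convex_on K h" "lsc_on K h" and x: "x \<in> K" and m: "m > 0"
  shows "bounded {u \<in> K. h u + m * (norm (u - x))\<^sup>2 \<le> c}"
proof -
  obtain b where b: "b \<ge> 0" "\<And>u. u \<in> K \<Longrightarrow> h x - 1 - b * norm (u - x) \<le> h u"
    using convex_lsc_affine_minorant[OF h x] by blast
  define a where "a = \<bar>c - h x + 1\<bar>"
  have "norm (u - x) \<le> (a + b) / m + 1" if u: "u \<in> K" "h u + m * (norm (u - x))\<^sup>2 \<le> c" for u
  proof (cases "norm (u - x) \<le> 1")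
    case True
    then show ?thesis using b(1) m by (simp add: a_def add_increasing)
  next
    case False
    define r where "r = norm (u - x)"
    have r: "r > 1" using False by (simp add: r_def)
    have "m * r\<^sup>2 \<le> a + b * r"
      using b(2)[OF u(1)] u(2) unfolding r_def[symmetric] a_def by linarith
    also have "\<dots> \<le> a * r + b * r"
      using r by (simp add: a_def mult_le_cancel_left1)
    finally have "(m * r) * r \<le> (a + b) * r"
      by (simp add: power2_eq_square algebra_simps)
    then have "m * r \<le> a + b" using r by simp
    then show ?thesis using m by (simp add: r_def[symmetric] field_simps)
  qed
  then have "{u \<in> K. h u + m * (norm (u - x))\<^sup>2 \<le> c} \<subseteq> cball x ((a + b) / m + 1)"
    by (auto simp: dist_norm norm_minus_commute)
  then show ?thesis using bounded_cball bounded_subset by blast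
qed

lemma convex_on_norm_diff_square:
  fixes v :: "'a::real_normed_vector"
  assumes "convex K"
  shows "convex_on K (\<lambda>u. (norm (u - v))\<^sup>2)"
proof -
  have 1: "convex_on K (\<lambda>u. norm (u - v))"
    using convex_on_dist[OF assms, of v] by (simp add: dist_norm norm_minus_commute)
  have "(norm (a *\<^sub>R x + b *\<^sub>R y - v))\<^sup>2 \<le> a * (norm (x - v))\<^sup>2 + b * (norm (y - v))\<^sup>2"
    if "x \<in> K" "y \<in> K" "0 \<le> a" "0 \<le> b" "a + b = 1" for x y a b
  proof -
    have "norm (a *\<^sub>R x + b *\<^sub>R y - v) \<le> a * norm (x - v) + b * norm (y - v)"
      using 1 that by (simp add: convex_on_def)
    then have "(norm (a *\<^sub>R x + b *\<^sub>R y - v))\<^sup>2 \<le> (a * norm (x - v) + b * norm (y - v))\<^sup>2"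
      by (intro power_mono) auto
    also have "\<dots> \<le> a * (norm (x - v))\<^sup>2 + b * (norm (y - v))\<^sup>2"
    proof -
      have "a * s\<^sup>2 + b * t\<^sup>2 - (a * s + b * t)\<^sup>2 = a * b * (s - t)\<^sup>2" for s t
      proof -
        have b: "b = 1 - a" using that by simp
        show ?thesis unfolding b by (simp add: power2_eq_square algebra_simps)
      qed
      moreover have "0 \<le> a * b * (norm (x - v) - norm (y - v))\<^sup>2"
        using that by simp
      ultimately show ?thesis by (metis diff_ge_0_iff_ge)
    qed
    finally show ?thesis .
  qed
  then show ?thesis using assms by (simp add: convex_on_def)
qed

lemma convex_sublevel:
  assumes "convex_on K h"
  shows "convex {u \<in> K. h u \<le> (c::real)}"
proof (rule convexI)
  fix x y and a b :: real
  assume xy: "x \<in> {u \<in> K. h u \<le> c}" "y \<in> {u \<in> K. h u \<le> c}" and ab: "0 \<le> a" "0 \<le> b" "a + b = 1"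
  have "h (a *\<^sub>R x + b *\<^sub>R y) \<le> a * h x + b * h y"
    using assms xy ab by (simp add: convex_on_def)
  also have "\<dots> \<le> c"
    using convex_bound_le[of "h x" c "h y" a b] xy ab by simp
  finally show "a *\<^sub>R x + b *\<^sub>R y \<in> {u \<in> K. h u \<le> c}"
    using assms xy ab by (auto simp: convex_on_def convex_def)
qed

section \<open>Strongly monotone equilibrium problems\<close>

text \<open>If no such \<open>u\<close> existed, the theorem of the alternative would give weights \<open>w\<close> with
  \<open>(\<Sum>v\<in>V. w v * G v u) \<ge> e\<close> for all \<open>u\<close>. At the barycentre \<open>u\<close> of \<open>V\<close> with the same weights, convexity
  bounds this sum by \<open>(\<Sum>v\<in>V. \<Sum>v'\<in>V. w v * w v' * G v v')\<close>, whose symmetrization is nonpositive. Monotonicity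
  here does the work for which the KKM lemma or Brouwer's theorem would otherwise be used. The slack
  \<open>e\<close> is what allows an argument by separation, without compactness of the convex hull of \<open>V\<close>.\<close>

lemma finite_approximate_minty_solution:
  fixes G :: "'a::real_vector \<Rightarrow> 'a \<Rightarrow> real"
  assumes conv: "\<And>v. v \<in> K \<Longrightarrow> convex_on K (G v)"
    and mono: "\<And>v w. v \<in> K \<Longrightarrow> w \<in> K \<Longrightarrow> G v w + G w v \<le> 0"
    and V: "finite V" "V \<noteq> {}" "V \<subseteq> K" and e: "e > 0"
  shows "\<exists>u\<in>K. \<forall>v\<in>V. G v u < e"
proof (rule ccontr)
  assume neg: "\<not> ?thesis"
  obtain v0 where "v0 \<in> V" using V by blast
  then have K: "convex K" using conv V by (auto simp: convex_on_def)
  have conv': "convex_on K (\<lambda>u. G v u + (- e))" if "v \<in> V" for v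
  proof (rule convex_on_add)
    show "convex_on K (G v)" using conv V(3) that by blast
    show "convex_on K (\<lambda>_. - e)" using K by (rule convex_on_const[THEN iffD2])
  qed
  have no: "\<exists>v\<in>V. 0 \<le> G v u + (- e)" if "u \<in> K" for u
    using neg that by (force simp: not_less)
  obtain w where w: "\<And>v. v \<in> V \<Longrightarrow> w v \<ge> 0" "sum w V = 1"
      "\<And>u. u \<in> K \<Longrightarrow> 0 \<le> (\<Sum>v\<in>V. w v * (G v u + (- e)))"
    using convex_alternative[OF V(1,2) conv' no] by blast
  have ge: "e \<le> (\<Sum>v\<in>V. w v * G v u)" if "u \<in> K" for u
    using w(3)[OF that] w(2) by (simp add: algebra_simps sum_subtractf flip: sum_distrib_left)
  define u where "u = (\<Sum>v\<in>V. w v *\<^sub>R v)"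
  have u: "u \<in> K"
    unfolding u_def using convex_sum[OF V(1) K w(2), of "\<lambda>v. v"] w(1) V(3) by auto
  define S where "S = (\<Sum>v\<in>V. \<Sum>v'\<in>V. w v * w v' * G v v')"
  have "G v u \<le> (\<Sum>v'\<in>V. w v' * G v v')" if "v \<in> V" for v
    unfolding u_def using that w(1,2) V by (intro convex_on_sum[OF _ _ conv]) auto
  then have "(\<Sum>v\<in>V. w v * G v u) \<le> (\<Sum>v\<in>V. w v * (\<Sum>v'\<in>V. w v' * G v v'))"
    using w(1) by (intro sum_mono mult_left_mono) auto
  also have "\<dots> = S"
    by (simp add: S_def sum_distrib_left mult.assoc)
  finally have "e \<le> S" using ge[OF u] by linarith
  moreover have "S = (\<Sum>v\<in>V. \<Sum>v'\<in>V. w v * w v' * G v' v)"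
    unfolding S_def by (subst sum.swap) (simp add: mult.commute)
  then have "S + S = (\<Sum>v\<in>V. \<Sum>v'\<in>V. w v * w v' * (G v v' + G v' v))"
    unfolding S_def by (simp add: distrib_left sum.distrib)
  moreover have "\<dots> \<le> 0"
    using w(1) V(3) by (intro sum_nonpos mult_nonneg_nonpos mono) auto
  ultimately show False using e by linarith
qed

text \<open>Half of the monotonicity gap is added to \<open>F\<close>: the function \<open>G v u = F v u + (m/2) |u - v|^2\<close> is
  still monotone, and the quadratic term makes its sublevel sets bounded. The approximate solutions for finitely
  many test points \<open>v\<close> and slack \<open>e\<close> form a directed family of closed convex bounded sets, and a common
  point solves the problem for all \<open>v\<close> without slack.\<close>

lemma minty_solution_exists:
  fixes F :: "'a::real_normed_vector \<Rightarrow> 'a \<Rightarrow> real"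
  assumes refl: "reflexive_space TYPE('a)"
    and K: "closed K" "convex K" "K \<noteq> {}"
    and m: "m > 0"
    and mono: "\<And>u v. u \<in> K \<Longrightarrow> v \<in> K \<Longrightarrow> F u v + F v u \<le> - m * (norm (u - v))\<^sup>2"
    and conv: "\<And>u. u \<in> K \<Longrightarrow> convex_on K (F u)"
    and lsc: "\<And>u. u \<in> K \<Longrightarrow> lsc_on K (F u)"
  shows "\<exists>u\<in>K. \<forall>v\<in>K. F v u \<le> 0"
proof -
  define G where "G v u = F v u + (m / 2) * (norm (u - v))\<^sup>2" for v u
  have Gconv: "convex_on K (G v)" if "v \<in> K" for v
    unfolding G_def using m conv[OF that] convex_on_norm_diff_square[OF K(2)]
    by (intro convex_on_add convex_on_cmul) auto
  have Glsc: "lsc_on K (G v)" if "v \<in> K" for v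
    unfolding G_def by (intro lsc_on_add_continuous lsc[OF that] continuous_intros)
  have Gmono: "G v w + G w v \<le> 0" if "v \<in> K" "w \<in> K" for v w
    using mono[OF that] by (simp add: G_def norm_minus_commute[of w v])
  obtain x where x: "x \<in> K" using K(3) by blast
  \<comment> \<open>the fixed test point \<open>x\<close> is always included because it makes every one of these sets bounded\<close>
  define S where "S V e = {u \<in> K. \<forall>v\<in>insert x V. G v u \<le> e}" for V :: "'a set" and e :: real
  define \<C> where "\<C> = {S V e | V e. finite V \<and> V \<subseteq> K \<and> e > 0}"
  have S_Inter: "S V e = (\<Inter>v\<in>insert x V. {u \<in> K. G v u \<le> e})" for V e
    by (auto simp: S_def)
  have "\<Inter>\<C> \<noteq> {}"
  proof (rule reflexive_directed_Inter[OF refl])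
    have "S {} 1 \<in> \<C>" unfolding \<C>_def by force
    then show "\<C> \<noteq> {}" by blast
  next
    fix C assume "C \<in> \<C>"
    then obtain V e where C: "C = S V e" and V: "finite V" "V \<subseteq> K" "e > 0"
      by (auto simp: \<C>_def)
    have sub: "v \<in> insert x V \<Longrightarrow> v \<in> K" for v using V x by auto
    have "closed C"
      unfolding C S_Inter using sub by (intro closed_INT ballI closed_lsc_sublevel K Glsc)
    moreover have "convex C"
      unfolding C S_Inter using sub by (intro convex_INT convex_sublevel Gconv)
    moreover have "C \<noteq> {}"
      using finite_approximate_minty_solution[of K G "insert x V" e, OF Gconv Gmono] V sub
      by (force simp: C S_def)
    moreover have "bounded C"
    proof (rule bounded_subset[OF bounded_sublevel_quadratic[OF conv[OF x] lsc[OF x] x]])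
      show "0 < m / 2" using m by simp
      show "C \<subseteq> {u \<in> K. F x u + (m / 2) * (norm (u - x))\<^sup>2 \<le> e}"
        by (auto simp: C S_def G_def)
    qed
    ultimately show "closed C \<and> convex C \<and> C \<noteq> {} \<and> bounded C" by blast
  next
    fix C D assume "C \<in> \<C>" "D \<in> \<C>"
    then obtain V e V' e' where C: "C = S V e" "finite V" "V \<subseteq> K" "e > 0"
      and D: "D = S V' e'" "finite V'" "V' \<subseteq> K" "e' > 0"
      by (auto simp: \<C>_def)
    have "S (V \<union> V') (min e e') \<in> \<C>"
      using C D unfolding \<C>_def by (auto intro!: exI[of _ "V \<union> V'"] exI[of _ "min e e'"])
    moreover have "S (V \<union> V') (min e e') \<subseteq> C \<inter> D"
      unfolding C(1) D(1) S_def by auto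
    ultimately show "\<exists>B\<in>\<C>. B \<subseteq> C \<inter> D" by blast
  qed
  then obtain u where u: "\<And>C. C \<in> \<C> \<Longrightarrow> u \<in> C" by blast
  have uS: "u \<in> S {v} e" if "v \<in> K" "e > 0" for v e
    using that by (intro u) (auto simp: \<C>_def)
  have "u \<in> K" using uS[OF x zero_less_one] by (simp add: S_def)
  moreover have "F v u \<le> 0" if v: "v \<in> K" for v
  proof -
    have "G v u \<le> 0"
      by (rule field_le_epsilon) (use uS[OF v] in \<open>simp add: S_def\<close>)
    moreover have "0 \<le> (m / 2) * (norm (u - v))\<^sup>2" using m by simp
    ultimately show ?thesis unfolding G_def by linarith
  qed
  ultimately show ?thesis by blast
qed

text \<open>Minty's argument: for \<open>w\<close> on the open segment from a solution \<open>u\<close> of the dual problem to \<open>v\<close>,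
  convexity and \<open>F w w = 0\<close>, \<open>F w u \<le> 0\<close> force \<open>F w v \<ge> 0\<close>. Upper semicontinuity along the segment lets
  \<open>w\<close> tend to \<open>u\<close>.\<close>

theorem strongly_monotone_equilibrium:
  fixes F :: "'a::real_normed_vector \<Rightarrow> 'a \<Rightarrow> real"
  assumes refl: "reflexive_space TYPE('a)"
    and K: "closed K" "convex K" "K \<noteq> {}"
    and m: "m > 0"
    and diag: "\<And>u. u \<in> K \<Longrightarrow> F u u = 0"
    and mono: "\<And>u v. u \<in> K \<Longrightarrow> v \<in> K \<Longrightarrow> F u v + F v u \<le> - m * (norm (u - v))\<^sup>2"
    and conv: "\<And>u. u \<in> K \<Longrightarrow> convex_on K (F u)"
    and lsc: "\<And>u. u \<in> K \<Longrightarrow> lsc_on K (F u)"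
    and hemi: "\<And>u v c. u \<in> K \<Longrightarrow> v \<in> K \<Longrightarrow> F u v < c \<Longrightarrow>
      \<forall>\<^sub>F t in at_right 0. F (u + t *\<^sub>R (v - u)) v < c"
  shows "\<exists>u\<in>K. \<forall>v\<in>K. 0 \<le> F u v"
proof -
  obtain u where u: "u \<in> K" "\<And>v. v \<in> K \<Longrightarrow> F v u \<le> 0"
    using minty_solution_exists[OF refl K m mono conv lsc] by blast
  have "0 \<le> F u v" if v: "v \<in> K" for v
  proof (rule ccontr)
    assume "\<not> 0 \<le> F u v"
    then have "\<forall>\<^sub>F t in at_right 0. F (u + t *\<^sub>R (v - u)) v < 0"
      using hemi[OF u(1) v] by simp
    moreover have "\<forall>\<^sub>F t in at_right (0::real). t \<in> {0<..<1}"
      by (rule eventually_at_right_real) simp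
    ultimately have "\<forall>\<^sub>F t in at_right (0::real). t \<in> {0<..<1} \<and> F (u + t *\<^sub>R (v - u)) v < 0"
      by eventually_elim simp
    then obtain t :: real where t: "0 < t" "t < 1" and neg: "F (u + t *\<^sub>R (v - u)) v < 0"
      using eventually_happens'[of "at_right (0::real)"] by auto
    define w where "w = u + t *\<^sub>R (v - u)"
    have w: "w = (1 - t) *\<^sub>R u + t *\<^sub>R v" by (simp add: w_def algebra_simps)
    have wK: "w \<in> K" unfolding w using K(2) u(1) v t by (auto simp: convex_def)
    have "0 = F w w" using diag[OF wK] by simp
    also have "\<dots> \<le> (1 - t) * F w u + t * F w v"
      using convex_onD[OF conv[OF wK], of t u v] t u(1) v w by simp
    also have "\<dots> < 0"
    proof -
      have "(1 - t) * F w u \<le> 0" using u(2)[OF wK] t by (simp add: mult_nonneg_nonpos)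
      moreover have "t * F w v < 0" using neg t by (simp add: w_def mult_pos_neg)
      ultimately show ?thesis by linarith
    qed
    finally show False by simp
  qed
  with u(1) show ?thesis by blast
qed

section \<open>Clarke's directional derivative\<close>

text \<open>This lemma and the next replace the upper limit by the two \<open>\<epsilon>\<close>-statements that characterize it.\<close>

lemma clarke_deriv_lessD:
  fixes g :: "'a::real_normed_vector \<Rightarrow> real"
  assumes g: "locally_lipschitz g" and c: "clarke_deriv g x v < c"
  shows "\<forall>\<^sub>F (y, l) in nhds x \<times>\<^sub>F at_right 0. (g (y + l *\<^sub>R v) - g y) / l < c"
proof -
  let ?L = "Limsup (nhds x \<times>\<^sub>F at_right 0) (\<lambda>(y, l). ereal ((g (y + l *\<^sub>R v) - g y) / l))"
  have "ereal (clarke_deriv g x v) = ?L"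
    using clarke_deriv_finite[OF g] by (simp add: clarke_deriv_def ereal_real)
  then have "?L < ereal c" using c by (metis ereal_less_eq(3) not_less)
  from Limsup_lessD[OF this] show ?thesis
    by (rule eventually_mono) (auto split: prod.splits)
qed

lemma clarke_deriv_leI:
  fixes g :: "'a::real_normed_vector \<Rightarrow> real"
  assumes g: "locally_lipschitz g"
    and le: "\<forall>\<^sub>F (y, l) in nhds x \<times>\<^sub>F at_right 0. (g (y + l *\<^sub>R v) - g y) / l \<le> c"
  shows "clarke_deriv g x v \<le> c"
proof -
  let ?L = "Limsup (nhds x \<times>\<^sub>F at_right 0) (\<lambda>(y, l). ereal ((g (y + l *\<^sub>R v) - g y) / l))"
  have "ereal (clarke_deriv g x v) = ?L"
    using clarke_deriv_finite[OF g] by (simp add: clarke_deriv_def ereal_real)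
  also have "?L \<le> ereal c"
    by (rule Limsup_bounded) (rule eventually_mono[OF le], auto)
  finally show ?thesis by simp
qed

text \<open>Moving the base point from \<open>y\<close> to \<open>y + l v\<close> does not affect limits, because the step tends to \<open>0\<close>.
  This is why Clarke's derivative, unlike the ordinary directional derivative, is subadditive in the
  direction.\<close>

lemma filterlim_clarke_shift:
  "filterlim (\<lambda>(y, l). (y + l *\<^sub>R v, l)) (nhds x \<times>\<^sub>F at_right 0)
     (nhds (x::'a::real_normed_vector) \<times>\<^sub>F at_right (0::real))"
proof -
  let ?F = "nhds x \<times>\<^sub>F at_right (0::real)"
  have fst: "((\<lambda>p. fst p) \<longlongrightarrow> x) ?F"
    using filterlim_fst by blast
  have snd: "((\<lambda>p. snd p) \<longlongrightarrow> (0::real)) ?F"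
    by (rule filterlim_mono[OF filterlim_snd[of "at_right 0" "nhds x"] at_within_le_nhds order_refl])
  have "((\<lambda>p. fst p + snd p *\<^sub>R v) \<longlongrightarrow> x + 0 *\<^sub>R v) ?F"
    by (intro tendsto_intros fst snd)
  then have "filterlim (\<lambda>p. (fst p + snd p *\<^sub>R v, snd p)) (nhds x \<times>\<^sub>F at_right 0) ?F"
    by (intro filterlim_Pair filterlim_snd) simp
  then show ?thesis by (simp add: case_prod_beta')
qed

lemma eventually_clarke_pos:
  "\<forall>\<^sub>F (y, l) in nhds x \<times>\<^sub>F at_right (0::real). l > 0"
  unfolding case_prod_beta
  by (rule eventually_compose_filterlim[OF _ filterlim_snd]) (simp add: eventually_at_right_less)

lemma clarke_deriv_add:
  fixes g :: "'a::real_normed_vector \<Rightarrow> real"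
  assumes g: "locally_lipschitz g"
  shows "clarke_deriv g x (v + w) \<le> clarke_deriv g x v + clarke_deriv g x w"
proof (rule field_le_epsilon)
  fix e :: real assume e: "e > 0"
  have 1: "\<forall>\<^sub>F (y, l) in nhds x \<times>\<^sub>F at_right 0.
      (g (y + l *\<^sub>R v) - g y) / l < clarke_deriv g x v + e / 2"
    using e by (intro clarke_deriv_lessD[OF g]) simp
  have 2: "\<forall>\<^sub>F (y, l) in nhds x \<times>\<^sub>F at_right 0.
      (g (y + l *\<^sub>R w) - g y) / l < clarke_deriv g x w + e / 2"
    using e by (intro clarke_deriv_lessD[OF g]) simp
  have 3: "\<forall>\<^sub>F (y, l) in nhds x \<times>\<^sub>F at_right 0.
      (g (y + l *\<^sub>R v + l *\<^sub>R w) - g (y + l *\<^sub>R v)) / l < clarke_deriv g x w + e / 2"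
    using eventually_compose_filterlim[OF 2 filterlim_clarke_shift[of v x]]
    by (simp add: case_prod_unfold)
  show "clarke_deriv g x (v + w) \<le> clarke_deriv g x v + clarke_deriv g x w + e"
  proof (rule clarke_deriv_leI[OF g])
    show "\<forall>\<^sub>F (y, l) in nhds x \<times>\<^sub>F at_right 0. (g (y + l *\<^sub>R (v + w)) - g y) / l
        \<le> clarke_deriv g x v + clarke_deriv g x w + e"
      using 1 3
    proof eventually_elim
      case (elim p)
      obtain y l where p: "p = (y, l)" by (cases p)
      have "(g (y + l *\<^sub>R (v + w)) - g y) / l =
          (g (y + l *\<^sub>R v + l *\<^sub>R w) - g (y + l *\<^sub>R v)) / l + (g (y + l *\<^sub>R v) - g y) / l"
        by (simp add: scaleR_add_right add.assoc add_divide_distrib[symmetric])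
      with elim show ?case by (simp add: p)
    qed
  qed
qed

lemma clarke_deriv_zero [simp]:
  fixes g :: "'a::real_normed_vector \<Rightarrow> real"
  shows "clarke_deriv g x 0 = 0"
proof -
  have "Limsup (nhds x \<times>\<^sub>F at_right 0) (\<lambda>_ :: 'a \<times> real. ereal 0) = 0"
    by (subst Limsup_const) (simp_all add: prod_filter_eq_bot)
  then show ?thesis
    unfolding clarke_deriv_def by (simp add: case_prod_unfold)
qed

lemma clarke_deriv_le_lipschitz:
  fixes g :: "'a::real_normed_vector \<Rightarrow> real"
  assumes g: "locally_lipschitz g"
  shows "\<exists>L\<ge>0. \<forall>v. clarke_deriv g x v \<le> L * norm v"
proof -
  from g obtain r L where r: "r > 0" and L: "L-lipschitz_on (cball x r) g"
    unfolding locally_lipschitz_def by blast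
  have "clarke_deriv g x v \<le> L * norm v" for v
  proof (rule clarke_deriv_leI[OF g])
    have "\<forall>\<^sub>F y in nhds x. dist y x < r"
      using r by (auto simp: eventually_nhds_metric)
    then have 0: "\<forall>\<^sub>F (y, l) in nhds x \<times>\<^sub>F at_right (0::real). dist y x < r"
      unfolding case_prod_beta by (rule eventually_compose_filterlim[OF _ filterlim_fst])
    have 1: "\<forall>\<^sub>F (y, l) in nhds x \<times>\<^sub>F at_right (0::real). dist (y + l *\<^sub>R v) x < r"
      using eventually_compose_filterlim[OF 0 filterlim_clarke_shift[of v x]]
      by (simp add: case_prod_unfold)
    show "\<forall>\<^sub>F (y, l) in nhds x \<times>\<^sub>F at_right 0. (g (y + l *\<^sub>R v) - g y) / l \<le> L * norm v"
      using 0 1 eventually_clarke_pos[of x]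
    proof eventually_elim
      case (elim p)
      obtain y l where p: "p = (y, l)" by (cases p)
      have "\<bar>g (y + l *\<^sub>R v) - g y\<bar> \<le> L * (l * norm v)"
        using lipschitz_onD[OF L, of "y + l *\<^sub>R v" y] elim
        by (simp add: p dist_real_def dist_commute[of x]) (simp add: dist_norm)
      then show ?case using elim by (simp add: p field_simps abs_le_iff)
    qed
  qed
  then show ?thesis using lipschitz_on_nonneg[OF L] by blast
qed

lemma clarke_deriv_scaleR:
  fixes g :: "'a::real_normed_vector \<Rightarrow> real"
  assumes g: "locally_lipschitz g" and c: "c \<ge> 0"
  shows "clarke_deriv g x (c *\<^sub>R v) = c * clarke_deriv g x v"
proof -
  have le: "clarke_deriv g x (c *\<^sub>R v) \<le> c * clarke_deriv g x v" if c: "c > 0" for c v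
  proof (rule field_le_epsilon)
    fix e :: real assume e: "e > 0"
    have 1: "\<forall>\<^sub>F (y, l) in nhds x \<times>\<^sub>F at_right 0.
        (g (y + l *\<^sub>R v) - g y) / l < clarke_deriv g x v + e / c"
      using e c by (intro clarke_deriv_lessD[OF g]) simp
    \<comment> \<open>a step \<open>l\<close> in direction \<open>c v\<close> is a step \<open>c l\<close> in direction \<open>v\<close>\<close>
    have "((\<lambda>p. c * snd p) \<longlongrightarrow> c * 0) (nhds x \<times>\<^sub>F at_right (0::real))"
      by (intro tendsto_intros filterlim_mono[OF filterlim_snd[of "at_right 0" "nhds x"] at_within_le_nhds order_refl])
    moreover have "\<forall>\<^sub>F p in nhds x \<times>\<^sub>F at_right (0::real). c * snd p \<in> {0<..} \<and> c * snd p \<noteq> 0"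
      using eventually_clarke_pos[of x] by eventually_elim (use c in auto)
    ultimately have "filterlim (\<lambda>p. c * snd p) (at_right 0) (nhds x \<times>\<^sub>F at_right (0::real))"
      by (auto simp: filterlim_at)
    then have "filterlim (\<lambda>p. (fst p, c * snd p)) (nhds x \<times>\<^sub>F at_right 0) (nhds x \<times>\<^sub>F at_right (0::real))"
      by (intro filterlim_Pair filterlim_fst)
    from eventually_compose_filterlim[OF 1 this]
    have 2: "\<forall>\<^sub>F (y, l) in nhds x \<times>\<^sub>F at_right 0.
        (g (y + (c * l) *\<^sub>R v) - g y) / (c * l) < clarke_deriv g x v + e / c"
      by (simp add: case_prod_unfold)
    show "clarke_deriv g x (c *\<^sub>R v) \<le> c * clarke_deriv g x v + e"
    proof (rule clarke_deriv_leI[OF g])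
      show "\<forall>\<^sub>F (y, l) in nhds x \<times>\<^sub>F at_right 0. (g (y + l *\<^sub>R c *\<^sub>R v) - g y) / l
          \<le> c * clarke_deriv g x v + e"
        using 2 eventually_clarke_pos[of x]
      proof eventually_elim
        case (elim p)
        obtain y l where p: "p = (y, l)" by (cases p)
        have l: "l > 0" using elim by (simp add: p)
        have "(g (y + l *\<^sub>R c *\<^sub>R v) - g y) / l = c * ((g (y + (c * l) *\<^sub>R v) - g y) / (c * l))"
          using c l by (simp add: mult.commute)
        also have "\<dots> \<le> c * (clarke_deriv g x v + e / c)"
          using elim c by (intro mult_left_mono) (auto simp: p)
        finally show ?case using c by (simp add: p distrib_left)
      qed
    qed
  qed
  show ?thesis
  proof (cases "c = 0")
    case True
    then show ?thesis by simp
  next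
    case False
    then have c: "c > 0" using assms by simp
    have "clarke_deriv g x ((1 / c) *\<^sub>R c *\<^sub>R v) \<le> (1 / c) * clarke_deriv g x (c *\<^sub>R v)"
      using c by (intro le) simp
    then have "c * clarke_deriv g x v \<le> clarke_deriv g x (c *\<^sub>R v)"
      using c by (simp add: field_simps)
    with le[OF c, of v] show ?thesis by simp
  qed
qed

text \<open>A bound for the difference quotients based in a neighbourhood of \<open>x\<close> is one for those based near
  any \<open>y\<close> in the interior of that neighbourhood.\<close>

lemma clarke_deriv_upper_semicontinuous:
  fixes g :: "'a::real_normed_vector \<Rightarrow> real"
  assumes g: "locally_lipschitz g" and c: "clarke_deriv g x v < c"
  shows "\<forall>\<^sub>F y in nhds x. clarke_deriv g y v < c"
proof -
  obtain c' where c': "clarke_deriv g x v < c'" "c' < c" using dense[OF c] by blast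
  from clarke_deriv_lessD[OF g c'(1)] obtain P Q where
    P: "eventually P (nhds x)" and Q: "eventually Q (at_right (0::real))" and
    PQ: "\<And>y l. P y \<Longrightarrow> Q l \<Longrightarrow> (g (y + l *\<^sub>R v) - g y) / l < c'"
    unfolding eventually_prod_filter by auto
  have "\<forall>\<^sub>F y in nhds x. eventually P (nhds y)"
    using P by (simp add: eventually_eventually)
  then show ?thesis
  proof eventually_elim
    case (elim y)
    have "clarke_deriv g y v \<le> c'"
    proof (rule clarke_deriv_leI[OF g])
      show "\<forall>\<^sub>F (z, l) in nhds y \<times>\<^sub>F at_right 0. (g (z + l *\<^sub>R v) - g z) / l \<le> c'"
        unfolding eventually_prod_filter using elim Q PQ
        by (intro exI[of _ P] exI[of _ Q]) (auto intro: less_imp_le)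
    qed
    with c'(2) show ?case by simp
  qed
qed

text \<open>Subadditivity turns the linear bound \<open>L * norm v\<close> into a Lipschitz estimate.\<close>

lemma continuous_on_clarke_deriv_direction:
  fixes g :: "'a::real_normed_vector \<Rightarrow> real"
  assumes g: "locally_lipschitz g"
  shows "continuous_on S (clarke_deriv g x)"
proof -
  obtain L where L: "L \<ge> 0" "\<And>v. clarke_deriv g x v \<le> L * norm v"
    using clarke_deriv_le_lipschitz[OF g] by blast
  have *: "clarke_deriv g x v - clarke_deriv g x w \<le> L * norm (v - w)" for v w
    using clarke_deriv_add[OF g, of x "v - w" w] L(2)[of "v - w"] by simp
  have "L-lipschitz_on S (clarke_deriv g x)"
  proof (rule lipschitz_onI[OF _ L(1)])
    fix v w
    show "dist (clarke_deriv g x v) (clarke_deriv g x w) \<le> L * dist v w"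
      using *[of v w] *[of w v] by (simp add: dist_real_def dist_norm abs_le_iff norm_minus_commute)
  qed
  then show ?thesis by (rule lipschitz_on_continuous_on)
qed

section \<open>Elliptic variational-hemivariational inequalities\<close>

text \<open>The relative neighbourhood filter of \<open>u\<close> in \<open>K\<close> that enters the definition of lower
  semicontinuity excludes \<open>u\<close> itself, and the segment stays inside \<open>K\<close> by convexity.\<close>

lemma eventually_along_segment_lsc:
  assumes \<phi>: "lsc_on K \<phi>" and K: "convex K" "u \<in> K" "v \<in> K" and e: "e > 0"
  shows "\<forall>\<^sub>F t in at_right (0::real). \<phi> u - e < \<phi> (u + t *\<^sub>R (v - u :: 'a::real_normed_vector))"
proof (cases "u = v")
  case True
  then show ?thesis using e by simp
next
  case False
  have "((\<lambda>t. u + t *\<^sub>R (v - u)) \<longlongrightarrow> u + 0 *\<^sub>R (v - u)) (at_right (0::real))"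
    by (intro tendsto_intros)
  moreover have in01: "\<forall>\<^sub>F t in at_right (0::real). t \<in> {0<..<1}"
    by (rule eventually_at_right_real) simp
  then have "\<forall>\<^sub>F t in at_right (0::real). u + t *\<^sub>R (v - u) \<in> K \<and> u + t *\<^sub>R (v - u) \<noteq> u"
  proof eventually_elim
    case (elim t)
    have "(1 - t) *\<^sub>R u + t *\<^sub>R v \<in> K"
      using K elim by (auto simp: convex_def)
    then show ?case using elim False by (simp add: algebra_simps)
  qed
  ultimately have "filterlim (\<lambda>t. u + t *\<^sub>R (v - u)) (at u within K) (at_right (0::real))"
    by (auto simp: filterlim_at)
  moreover have "\<forall>\<^sub>F y in at u within K. \<phi> u - e < \<phi> y"
    using \<phi> K(2) e by (simp add: lsc_on_def)
  ultimately show ?thesis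
    using eventually_compose_filterlim by blast
qed

lemma convex_on_affine_comp:
  assumes h: "convex_on UNIV h" and K: "convex K" and G: "linear G"
  shows "convex_on K (\<lambda>v. h (G v - z))"
proof -
  have "h (G (a *\<^sub>R x + b *\<^sub>R y) - z) \<le> a * h (G x - z) + b * h (G y - z)"
    if "0 \<le> a" "0 \<le> b" "a + b = 1" for a b x y
  proof -
    have "z = a *\<^sub>R z + b *\<^sub>R z" using that by (metis scaleR_add_left scaleR_one)
    then have "G (a *\<^sub>R x + b *\<^sub>R y) - z = a *\<^sub>R (G x - z) + b *\<^sub>R (G y - z)"
      using linear_add[OF G] linear_cmul[OF G] by (simp add: algebra_simps)
    then show ?thesis using h that by (simp add: convex_on_def)
  qed
  then show ?thesis using K by (simp add: convex_on_def)
qed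

lemma convex_on_blinfun:
  fixes \<xi> :: "'a::real_normed_vector dual"
  shows "convex_on UNIV (blinfun_apply \<xi>)"
  by (simp add: convex_on_def blinfun.add_right blinfun.scaleR_right)

lemma convex_on_clarke_deriv:
  assumes "locally_lipschitz g"
  shows "convex_on UNIV (clarke_deriv g x)"
  using clarke_deriv_add[OF assms, of x] clarke_deriv_scaleR[OF assms, of _ x]
  unfolding convex_on_def by (metis convex_UNIV)

text \<open>The inequality says \<open>F u v \<ge> 0\<close> for the bifunction \<open>F\<close> that collects all terms with \<open>g\<close> and
  \<open>\<eta>\<close> moved to the left. By \<open>mono\<close> the nonsmooth terms contribute nothing positive to
  \<open>F u v + F v u\<close>, so that the strong monotonicity of \<open>A\<close> carries over to \<open>F\<close>. It gives uniqueness
  at once, and existence through the equilibrium theorem.\<close>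

theorem variational_hemivariational_unique_solution:
  fixes K :: "'x::real_normed_vector set"
    and \<gamma> :: "'x \<Rightarrow>\<^sub>L 'z::real_normed_vector"
    and A :: "'x \<Rightarrow> 'x dual" and jc :: "'z \<Rightarrow> 'z dual"
    and \<phi> :: "'x \<Rightarrow> real" and j :: "'z \<Rightarrow> real"
    and g :: "'x dual" and \<eta> :: "'z dual"
  assumes reflexive: "reflexive_space TYPE('x)"
    and K: "closed K" "convex K" "K \<noteq> {}"
    and A: "continuous_on UNIV A" "m > 0" "strongly_monotone m A"
    and \<phi>: "convex_on K \<phi>" "lsc_on K \<phi>"
    and j: "locally_lipschitz j"
    and jc: "continuous_on UNIV jc"
    and mono: "\<And>y z. clarke_deriv j y (z - y) + clarke_deriv j z (y - z) \<le> (jc y - jc z) (y - z)"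
  shows "\<exists>!u. u \<in> K \<and> (\<forall>v\<in>K. g (v - u) + \<eta> (\<gamma> v - \<gamma> u)
      \<le> A u (v - u) + \<phi> v - \<phi> u + clarke_deriv j (\<gamma> u) (\<gamma> v - \<gamma> u) + jc (\<gamma> u) (\<gamma> v - \<gamma> u))"
proof -
  define F where "F u v = (A u - g) (v - u) + clarke_deriv j (\<gamma> u) (\<gamma> v - \<gamma> u)
      + (jc (\<gamma> u) - \<eta>) (\<gamma> v - \<gamma> u) + \<phi> v - \<phi> u" for u v
  have F_ge: "0 \<le> F u v \<longleftrightarrow> g (v - u) + \<eta> (\<gamma> v - \<gamma> u)
      \<le> A u (v - u) + \<phi> v - \<phi> u + clarke_deriv j (\<gamma> u) (\<gamma> v - \<gamma> u) + jc (\<gamma> u) (\<gamma> v - \<gamma> u)" for u v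
    unfolding F_def blinfun.diff_left by linarith
  have Fmono: "F u v + F v u \<le> - m * (norm (u - v))\<^sup>2" for u v
  proof -
    have "(A u - g) (v - u) + (A v - g) (u - v) = - (A u - A v) (u - v)"
      by (simp add: blinfun.diff_left blinfun.diff_right)
    also have "\<dots> \<le> - m * (norm (u - v))\<^sup>2"
      using A(3) by (simp add: strongly_monotone_def)
    finally have 1: "(A u - g) (v - u) + (A v - g) (u - v) \<le> - m * (norm (u - v))\<^sup>2" .
    have "(jc (\<gamma> u) - \<eta>) (\<gamma> v - \<gamma> u) + (jc (\<gamma> v) - \<eta>) (\<gamma> u - \<gamma> v)
        = - (jc (\<gamma> u) - jc (\<gamma> v)) (\<gamma> u - \<gamma> v)"
      by (simp add: blinfun.diff_left blinfun.diff_right)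
    with 1 mono[of "\<gamma> u" "\<gamma> v"] show ?thesis unfolding F_def by linarith
  qed
  have ex: "\<exists>u\<in>K. \<forall>v\<in>K. 0 \<le> F u v"
  proof (rule strongly_monotone_equilibrium[OF reflexive K A(2)])
    show "F u u = 0" for u by (simp add: F_def)
    show "F u v + F v u \<le> - m * (norm (u - v))\<^sup>2" for u v by (rule Fmono)
    fix u assume u: "u \<in> K"
    define L where "L v = (A u - g) (v - u) + clarke_deriv j (\<gamma> u) (\<gamma> v - \<gamma> u)
      + (jc (\<gamma> u) - \<eta>) (\<gamma> v - \<gamma> u) - \<phi> u" for v
    have F_eq: "F u = (\<lambda>v. \<phi> v + L v)" by (auto simp: F_def L_def)
    have lin\<gamma>: "linear (blinfun_apply \<gamma>)"
      by (simp add: blinfun.bounded_linear_right bounded_linear.linear)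
    have cvc: "convex_on K (\<lambda>_. - \<phi> u)"
      using K(2) by (rule convex_on_const[THEN iffD2])
    have "convex_on K L"
      unfolding L_def diff_conv_add_uminus[of _ "\<phi> u"]
      using convex_on_affine_comp[OF convex_on_blinfun K(2) linear_ident, of "A u - g" u]
        convex_on_affine_comp[OF convex_on_clarke_deriv[OF j] K(2) lin\<gamma>, of "\<gamma> u" "\<gamma> u"]
        convex_on_affine_comp[OF convex_on_blinfun K(2) lin\<gamma>, of "jc (\<gamma> u) - \<eta>" "\<gamma> u"]
      by (intro convex_on_add cvc) auto
    then show "convex_on K (F u)"
      unfolding F_eq by (intro convex_on_add \<phi>)
    have "continuous_on K (\<lambda>v. clarke_deriv j (\<gamma> u) (\<gamma> v - \<gamma> u))"
      by (rule continuous_on_compose2[OF continuous_on_clarke_deriv_direction[OF j, of UNIV]])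
        (auto intro!: continuous_intros)
    then have "continuous_on K L"
      unfolding L_def by (intro continuous_intros)
    then show "lsc_on K (F u)"
      unfolding F_eq by (intro lsc_on_add_continuous \<phi>)
    fix v c assume v: "v \<in> K" and c: "F u v < c"
    \<comment> \<open>one third of the gap for each of the continuous part, \<open>- \<phi>\<close>, and Clarke's derivative\<close>
    define e where "e = (c - F u v) / 3"
    have e: "e > 0" using c by (simp add: e_def)
    let ?w = "\<lambda>t::real. u + t *\<^sub>R (v - u)"
    have wlim: "(?w \<longlongrightarrow> u) (at_right 0)"
      by (rule tendsto_eq_intros refl | simp)+
    have glim: "((\<lambda>t. \<gamma> (?w t)) \<longlongrightarrow> \<gamma> u) (at_right 0)"
      by (intro tendsto_intros wlim)
    have Alim: "((\<lambda>t. A (?w t)) \<longlongrightarrow> A u) (at_right 0)"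
      using continuous_on_tendsto_compose[OF A(1) wlim] by simp
    have jclim: "((\<lambda>t. jc (\<gamma> (?w t))) \<longlongrightarrow> jc (\<gamma> u)) (at_right 0)"
      using continuous_on_tendsto_compose[OF jc glim] by simp
    define H where "H t = (A (?w t) - g) (v - ?w t) + (jc (\<gamma> (?w t)) - \<eta>) (\<gamma> v - \<gamma> (?w t)) + \<phi> v" for t
    have "(H \<longlongrightarrow> (A u - g) (v - u) + (jc (\<gamma> u) - \<eta>) (\<gamma> v - \<gamma> u) + \<phi> v) (at_right 0)"
      unfolding H_def by (intro tendsto_intros wlim glim Alim jclim)
    then have 1: "\<forall>\<^sub>F t in at_right 0. H t < (A u - g) (v - u) + (jc (\<gamma> u) - \<eta>) (\<gamma> v - \<gamma> u) + \<phi> v + e"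
      using e by (intro order_tendstoD(2)) auto
    have 2: "\<forall>\<^sub>F t in at_right 0. \<phi> u - e < \<phi> (?w t)"
      by (rule eventually_along_segment_lsc[OF \<phi>(2) K(2) u v e])
    define d where "d = clarke_deriv j (\<gamma> u) (\<gamma> v - \<gamma> u)"
    have "\<forall>\<^sub>F z in nhds (\<gamma> u). clarke_deriv j z (\<gamma> v - \<gamma> u) < d + e / 2"
      using e by (intro clarke_deriv_upper_semicontinuous[OF j]) (simp add: d_def)
    then have 3: "\<forall>\<^sub>F t in at_right 0. clarke_deriv j (\<gamma> (?w t)) (\<gamma> v - \<gamma> u) < d + e / 2"
      by (rule eventually_compose_filterlim[OF _ glim])
    have "((\<lambda>t. (1 - t) * (d + e / 2)) \<longlongrightarrow> (1 - 0) * (d + e / 2)) (at_right (0::real))"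
      by (intro tendsto_intros)
    then have 4: "\<forall>\<^sub>F t in at_right 0. (1 - t) * (d + e / 2) < d + e"
      using e by (intro order_tendstoD(2)) auto
    have 5: "\<forall>\<^sub>F t in at_right (0::real). t \<in> {0<..<1}"
      by (rule eventually_at_right_real) simp
    show "\<forall>\<^sub>F t in at_right 0. F (?w t) v < c"
      using 1 2 3 4 5
    proof eventually_elim
      case (elim t)
      \<comment> \<open>the direction is a positive multiple of a fixed one, so semicontinuity in the base point
        alone is enough\<close>
      have "\<gamma> v - \<gamma> (?w t) = (1 - t) *\<^sub>R (\<gamma> v - \<gamma> u)"
        by (simp add: blinfun.add_right blinfun.scaleR_right blinfun.diff_right algebra_simps)
      then have "clarke_deriv j (\<gamma> (?w t)) (\<gamma> v - \<gamma> (?w t))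
          = (1 - t) * clarke_deriv j (\<gamma> (?w t)) (\<gamma> v - \<gamma> u)"
        using clarke_deriv_scaleR[OF j] elim(5) by simp
      also have "\<dots> \<le> (1 - t) * (d + e / 2)"
        using elim(3,5) by (intro mult_left_mono) auto
      finally have "clarke_deriv j (\<gamma> (?w t)) (\<gamma> v - \<gamma> (?w t)) < d + e"
        using elim(4) by linarith
      moreover have "F (?w t) v = H t + clarke_deriv j (\<gamma> (?w t)) (\<gamma> v - \<gamma> (?w t)) - \<phi> (?w t)"
        by (simp add: F_def H_def)
      moreover have "F u v + 3 * e = c" by (simp add: e_def field_simps)
      moreover have "F u v = (A u - g) (v - u) + (jc (\<gamma> u) - \<eta>) (\<gamma> v - \<gamma> u) + \<phi> v + d - \<phi> u"
        by (simp add: F_def d_def)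
      ultimately show ?case using elim(1,2) by linarith
    qed
  qed
  have uniq: "u = u'" if "u \<in> K" "u' \<in> K" "\<And>v. v \<in> K \<Longrightarrow> 0 \<le> F u v" "\<And>v. v \<in> K \<Longrightarrow> 0 \<le> F u' v" for u u'
  proof -
    have "m * (norm (u - u'))\<^sup>2 \<le> 0"
      using Fmono[of u u'] that(3)[OF that(2)] that(4)[OF that(1)] by simp
    then show ?thesis using A(2) by (simp add: mult_le_0_iff)
  qed
  show ?thesis
    unfolding F_ge[symmetric] using ex uniq by blast
qed

section \<open>The time-stepping scheme\<close>

text \<open>If the \<open>n\<close>-th relation involves the sequence only through its earlier terms, then existence and
  uniqueness of each single step give existence and uniqueness of the sequence.\<close>

lemma unique_recursive_sequence:
  fixes Q :: "nat \<Rightarrow> (nat \<Rightarrow> 'a) \<Rightarrow> 'a \<Rightarrow> bool"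
  assumes causal: "\<And>n u u' x. n \<in> {1..N} \<Longrightarrow> (\<And>i. i < n \<Longrightarrow> u i = u' i) \<Longrightarrow> Q n u x = Q n u' x"
    and step: "\<And>n u. n \<in> {1..N} \<Longrightarrow> (\<And>i. i < n \<Longrightarrow> u i \<in> K) \<Longrightarrow> \<exists>!x. x \<in> K \<and> Q n u x"
    and x0: "x0 \<in> K"
  shows "\<exists>!u. u \<in> {0..N} \<rightarrow>\<^sub>E K \<and> u 0 = x0 \<and> (\<forall>n\<in>{1..N}. Q n u (u n))"
proof -
  \<comment> \<open>past \<open>N\<close> the value is \<open>undefined\<close>, so that the sequence is extensional on \<open>{0..N}\<close>\<close>
  define P where "P u n x \<longleftrightarrow>
    (if n = 0 then x = x0 else if n \<le> N then x \<in> K \<and> Q n u x else x = undefined)" for u n x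
  have "\<exists>u. \<forall>n. P u n (u n)"
  proof (rule dependent_wellorder_choice)
    show "P u n x = P u' n x" if "\<And>i. i < n \<Longrightarrow> u i = u' i" for x u u' n
      using causal[of n u u' x] that by (auto simp: P_def)
  next
    fix n u assume prev: "\<And>i. i < n \<Longrightarrow> P u i (u i)"
    show "\<exists>x. P u n x"
    proof (cases "n \<in> {1..N}")
      case True
      have uK: "u i \<in> K" if "i < n" for i
        using prev[OF that] that True x0 by (auto simp: P_def split: if_splits)
      have "\<exists>!x. x \<in> K \<and> Q n u x"
        by (rule step[OF True]) (rule uK)
      then show ?thesis using True by (auto simp: P_def)
    next
      case False
      then show ?thesis by (auto simp: P_def)
    qed
  qed
  then obtain u where u: "\<And>n. P u n (u n)" by blast
  show ?thesis
  proof (rule ex1I)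
    show "u \<in> {0..N} \<rightarrow>\<^sub>E K \<and> u 0 = x0 \<and> (\<forall>n\<in>{1..N}. Q n u (u n))"
    proof (intro conjI PiE_I ballI)
      show "u n \<in> K" if "n \<in> {0..N}" for n
        using u[of n] that x0 by (auto simp: P_def split: if_splits)
      show "u n = undefined" if "n \<notin> {0..N}" for n
        using u[of n] that by (auto simp: P_def split: if_splits)
      show "u 0 = x0" using u[of 0] by (simp add: P_def)
      show "Q n u (u n)" if "n \<in> {1..N}" for n
        using u[of n] that by (auto simp: P_def)
    qed
  next
    fix u' assume u': "u' \<in> {0..N} \<rightarrow>\<^sub>E K \<and> u' 0 = x0 \<and> (\<forall>n\<in>{1..N}. Q n u' (u' n))"
    have "u' n = u n" for n
    proof (induction n rule: less_induct)
      case (less n)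
      consider "n = 0" | "n \<in> {1..N}" | "n > N" by force
      then show ?case
      proof cases
        case 1
        then show ?thesis using u' u[of 0] by (simp add: P_def)
      next
        case 2
        have K: "u i \<in> K" if "i < n" for i
          using u[of i] that 2 x0 by (auto simp: P_def split: if_splits)
        have "\<exists>!x. x \<in> K \<and> Q n u x"
          by (rule step[OF 2]) (rule K)
        moreover have "u' n \<in> K \<and> Q n u (u' n)"
        proof -
          have "Q n u' (u' n) = Q n u (u' n)"
            by (rule causal[OF 2]) (rule less.IH)
          then show ?thesis using u' 2 by (auto simp: PiE_iff)
        qed
        moreover have "u n \<in> K \<and> Q n u (u n)"
          using u[of n] 2 by (auto simp: P_def)
        ultimately show ?thesis by blast
      next
        case 3
        then show ?thesis using u' u[of n] by (auto simp: P_def PiE_iff extensional_def)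
      qed
    qed
    then show "u' = u" by blast
  qed
qed

text \<open>The history operator looks strictly into the past, so the scheme can be solved one step at a time.\<close>

lemma hist_sum_cong:
  assumes "n \<ge> 1" "\<And>i. i < n \<Longrightarrow> u i = u' i"
  shows "hist_sum R q a k u n = hist_sum R q a k u' n"
proof -
  have "(\<Sum>i=1..n-1. q (real n * k) (real i * k) (u i)) = (\<Sum>i=1..n-1. q (real n * k) (real i * k) (u' i))"
    using assms by (intro sum.cong) auto
  then show ?thesis
    using assms by (simp add: hist_sum_def)
qed

theorem theorem7:
  fixes K :: "'x::banach set"
    and \<gamma>\<^sub>j :: "'x \<Rightarrow>\<^sub>L 'xj::banach"
    and A :: "'x \<Rightarrow> 'x dual"
    and \<phi> :: "'y::real_normed_vector \<Rightarrow> 'x \<Rightarrow> 'x \<Rightarrow> real"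
    and j :: "'xj \<Rightarrow> real"
    and f :: "real \<Rightarrow> 'x dual"
    and R :: "'x \<Rightarrow>\<^sub>L 'y"
    and q :: "real \<Rightarrow> real \<Rightarrow> 'x \<Rightarrow>\<^sub>L 'x"
    and a\<^sub>S :: "'x"
    and j\<^sub>c :: "'xj \<Rightarrow> 'xj dual"
    and c\<^sub>j L\<^sub>A m\<^sub>A \<alpha>\<^sub>\<phi> \<beta>\<^sub>\<phi> c\<^sub>0 c\<^sub>1 \<alpha>\<^sub>j \<alpha>\<^sub>c T k :: real
    and N :: nat
    and u0 :: "'x"
  assumes X_reflexive: "reflexive_space TYPE('x)"
    and K: "closed K" "convex K" "0 \<in> K"
    and \<gamma>\<^sub>j_bound: "c\<^sub>j > 0" "\<And>v. norm (\<gamma>\<^sub>j v) \<le> c\<^sub>j * norm v"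
    and A_lipschitz: "L\<^sub>A > 0" "L\<^sub>A-lipschitz_on UNIV A"
    and A_monotone: "m\<^sub>A > 0" "strongly_monotone m\<^sub>A A"
    and \<phi>_convex_lsc: "\<And>y u. u \<in> K \<Longrightarrow> convex_on K (\<phi> y u) \<and> lsc_on K (\<phi> y u)"
    and \<phi>_bound: "\<alpha>\<^sub>\<phi> > 0" "\<beta>\<^sub>\<phi> > 0"
      "\<And>y1 y2 u1 u2 v1 v2. \<lbrakk>u1 \<in> K; u2 \<in> K; v1 \<in> K; v2 \<in> K\<rbrakk> \<Longrightarrow>
         \<phi> y1 u1 v2 - \<phi> y1 u1 v1 + \<phi> y2 u2 v1 - \<phi> y2 u2 v2
         \<le> \<alpha>\<^sub>\<phi> * norm (u1 - u2) * norm (v1 - v2) + \<beta>\<^sub>\<phi> * norm (y1 - y2) * norm (v1 - v2)"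
    and j_lipschitz: "locally_lipschitz j"
    and j_growth: "c\<^sub>0 \<ge> 0" "c\<^sub>1 \<ge> 0"
      "\<And>z \<xi>. \<xi> \<in> clarke_subdiff j z \<Longrightarrow> norm \<xi> \<le> c\<^sub>0 + c\<^sub>1 * norm z"
    and j_relaxed: "\<alpha>\<^sub>j > 0"
      "\<And>z1 z2. clarke_deriv j z1 (z2 - z1) + clarke_deriv j z2 (z1 - z2) \<le> \<alpha>\<^sub>j * (norm (z1 - z2))\<^sup>2"
    and f_cont: "continuous_on {0..} f"
    and q_cont: "continuous_on ({0..} \<times> {0..}) (\<lambda>(t, s). q t s)"
    and j\<^sub>c: "linear j\<^sub>c"
      "\<And>z. norm (j\<^sub>c z) \<le> \<alpha>\<^sub>c * norm z"
      "\<And>z. j\<^sub>c z z \<ge> \<alpha>\<^sub>j * (norm z)\<^sup>2"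
    and discretization: "T > 0" "N > 0" "k = T / real N"
    and u0: "u0 \<in> K"
  shows "\<exists>!u. u \<in> {0..N} \<rightarrow>\<^sub>E K \<and> u 0 = u0 \<and>
    (\<forall>n\<in>{1..N}. \<forall>v\<in>K.
       A (u n) (v - u n)
       + \<phi> (hist_sum R q a\<^sub>S k u n) (u (n - 1)) v
       - \<phi> (hist_sum R q a\<^sub>S k u n) (u (n - 1)) (u n)
       + clarke_deriv j (\<gamma>\<^sub>j (u n)) (\<gamma>\<^sub>j v - \<gamma>\<^sub>j (u n))
       + j\<^sub>c (\<gamma>\<^sub>j (u n)) (\<gamma>\<^sub>j v - \<gamma>\<^sub>j (u n))
       \<ge> f (real n * k) (v - u n)
       + j\<^sub>c (\<gamma>\<^sub>j (u (n - 1))) (\<gamma>\<^sub>j v - \<gamma>\<^sub>j (u n)))"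
proof -
  let ?Q = "\<lambda>n u x. \<forall>v\<in>K.
       f (real n * k) (v - x) + j\<^sub>c (\<gamma>\<^sub>j (u (n - 1))) (\<gamma>\<^sub>j v - \<gamma>\<^sub>j x)
       \<le> A x (v - x)
       + \<phi> (hist_sum R q a\<^sub>S k u n) (u (n - 1)) v
       - \<phi> (hist_sum R q a\<^sub>S k u n) (u (n - 1)) x
       + clarke_deriv j (\<gamma>\<^sub>j x) (\<gamma>\<^sub>j v - \<gamma>\<^sub>j x)
       + j\<^sub>c (\<gamma>\<^sub>j x) (\<gamma>\<^sub>j v - \<gamma>\<^sub>j x)"
  have A_cont: "continuous_on UNIV A"
    using A_lipschitz(2) by (rule lipschitz_on_continuous_on)
  have "bounded_linear j\<^sub>c"
    using j\<^sub>c(1,2) by (intro bounded_linear_intro[of _ \<alpha>\<^sub>c])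
      (auto simp: linear_add linear_cmul mult.commute)
  then have jc_cont: "continuous_on UNIV j\<^sub>c"
    by (rule linear_continuous_on)
  \<comment> \<open>the stabilizing term \<open>j\<^sub>c\<close> compensates the relaxed monotonicity of \<open>j\<close> exactly\<close>
  have mono: "clarke_deriv j y (z - y) + clarke_deriv j z (y - z) \<le> (j\<^sub>c y - j\<^sub>c z) (y - z)" for y z
    using j_relaxed(2)[of y z] j\<^sub>c(3)[of "y - z"] linear_diff[OF j\<^sub>c(1), of y z] by simp
  have "\<exists>!u. u \<in> {0..N} \<rightarrow>\<^sub>E K \<and> u 0 = u0 \<and> (\<forall>n\<in>{1..N}. ?Q n u (u n))"
  proof (rule unique_recursive_sequence[OF _ _ u0])
    fix n x and u u' :: "nat \<Rightarrow> 'x"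
    assume n: "n \<in> {1..N}" and eq: "\<And>i. i < n \<Longrightarrow> u i = u' i"
    have "hist_sum R q a\<^sub>S k u n = hist_sum R q a\<^sub>S k u' n"
      using n eq by (intro hist_sum_cong) auto
    moreover have "u (n - 1) = u' (n - 1)" using n by (intro eq) auto
    ultimately show "?Q n u x = ?Q n u' x" by simp
  next
    fix n and u :: "nat \<Rightarrow> 'x"
    assume n: "n \<in> {1..N}" and prev: "\<And>i. i < n \<Longrightarrow> u i \<in> K"
    have "u (n - 1) \<in> K" using n by (intro prev) auto
    then have \<phi>: "convex_on K (\<phi> (hist_sum R q a\<^sub>S k u n) (u (n - 1)))"
      "lsc_on K (\<phi> (hist_sum R q a\<^sub>S k u n) (u (n - 1)))"
      using \<phi>_convex_lsc by auto
    have ne: "K \<noteq> {}" using u0 by blast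
    show "\<exists>!x. x \<in> K \<and> ?Q n u x"
      by (rule variational_hemivariational_unique_solution[OF X_reflexive K(1,2) ne A_cont A_monotone
            \<phi> j_lipschitz jc_cont mono])
  qed
  then show ?thesis .
qed

end
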